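(* Let $D\subset\mathbb{C}^n$ be a domain and let $U$ be a neighborhood of a local holomorphic peak point $p_0\in\partial D$. If $\lim_{z\to p_0}h^k_{D\cap U}(z)=1$, then $\lim_{z\to p_0}h^k_D(z)=1$, where $h^k$ denotes the Fridman invariant with respect to the Kobayashi pseudodistance.
   Context: $\mathbb{B}_n\subset\mathbb{C}^n$ is the open unit ball, $\Delta\subset\mathbb{C}$ the open unit disc, $\mathcal{O}(X,Y)$ the set of holomorphic maps from $X$ to $Y$. Lempert function: $l_D(z,w)=\inf\{\tanh^{-1}|\lambda| : f\in\mathcal{O}(\Delta,D),\ f(0)=z,\ f(\lambda)=w\}$ (with $\inf\emptyset=\infty$). The Kobayashi pseudodistance $k_D$ is the largest pseudodistance on $D$ not exceeding $l_D$. Fridman invariant: for $z\in D$, $$h^k_D(z)=\sup\{\tanh r : r>0,\ B^k_D(z,r)\subset f(\mathbb{B}_n),\ f\in\mathcal{O}(\mathbb{B}_n,D),\ f\text{ injective}\},$$ where $B^k_D(z,r)=\{w\in D: k_D(z,w)<r\}$; the value $0$ is allowed (supremum of the empty set is $0$). The same definitions are used for the open set $D\cap U$ (with $k_{D\cap U}=\infty$ between points of different connected components). Limits as $z\to p_0$ are taken over points of the corresponding set ($D$ or $D\cap U$). A point $p_0\in\partial D$ is a local holomorphic peak point if there are a neighborhood $W$ of $p_0$ and a function $f$ holomorphic on $D\cap W$ and continuous on $\overline{D}\cap W$ such that $f(p_0)=1$ and $|f|<1$ on $(\overline{D}\cap W)\setminus\{p_0\}$. *)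

theory Defs
  imports "HOL-Complex_Analysis.Complex_Analysis"
begin

definition domain :: "(complex ^ 'n) set \<Rightarrow> bool" where
  "domain D \<longleftrightarrow> open D \<and> connected D \<and> D \<noteq> {}"

text \<open>
  Holomorphy in several variables is Frechet differentiability with a complex-linear derivative.
  It is only used on open sets, where \<open>at z within S\<close> coincides with \<open>at z\<close>.
\<close>

definition holomorphic_fun_on :: "(complex ^ 'n) set \<Rightarrow> (complex ^ 'n \<Rightarrow> complex) \<Rightarrow> bool" where
  "holomorphic_fun_on S f \<longleftrightarrow>
     (\<forall>z\<in>S. \<exists>f'. (f has_derivative f') (at z within S) \<and> (\<forall>c v. f' (c *s v) = c * f' v))"

definition holomorphic_map_on ::
    "(complex ^ 'm) set \<Rightarrow> (complex ^ 'n) set \<Rightarrow> (complex ^ 'm \<Rightarrow> complex ^ 'n) \<Rightarrow> bool" where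
  "holomorphic_map_on S T f \<longleftrightarrow> (\<forall>i. holomorphic_fun_on S (\<lambda>z. f z $ i)) \<and> f ` S \<subseteq> T"

definition holomorphic_disc :: "(complex ^ 'n) set \<Rightarrow> (complex \<Rightarrow> complex ^ 'n) \<Rightarrow> bool" where
  "holomorphic_disc D f \<longleftrightarrow> (\<forall>i. (\<lambda>\<zeta>. f \<zeta> $ i) holomorphic_on ball 0 1) \<and> f ` ball 0 1 \<subseteq> D"

text \<open>The infimum is taken in \<^typ>\<open>ennreal\<close>, so it is \<open>\<infinity>\<close> when no disc joins the two points.\<close>

definition lempert :: "(complex ^ 'n) set \<Rightarrow> complex ^ 'n \<Rightarrow> complex ^ 'n \<Rightarrow> ennreal" where
  "lempert D z w =
     Inf {ennreal (artanh (norm \<mu>)) | f \<mu>.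
            \<mu> \<in> ball 0 1 \<and> holomorphic_disc D f \<and> f 0 = z \<and> f \<mu> = w}"

text \<open>
  Pseudodistances may take the value \<open>\<infinity>\<close>, so that the definitions also apply to disconnected
  open sets.
\<close>

definition pseudodistance_on :: "'a set \<Rightarrow> ('a \<Rightarrow> 'a \<Rightarrow> ennreal) \<Rightarrow> bool" where
  "pseudodistance_on D d \<longleftrightarrow>
     (\<forall>x\<in>D. d x x = 0) \<and> (\<forall>x\<in>D. \<forall>y\<in>D. d x y = d y x) \<and>
     (\<forall>x\<in>D. \<forall>y\<in>D. \<forall>z\<in>D. d x z \<le> d x y + d y z)"

definition below_lempert ::
    "(complex ^ 'n) set \<Rightarrow> (complex ^ 'n \<Rightarrow> complex ^ 'n \<Rightarrow> ennreal) \<Rightarrow> bool" where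
  "below_lempert D d \<longleftrightarrow> (\<forall>z\<in>D. \<forall>w\<in>D. d z w \<le> lempert D z w)"

text \<open>
  The pointwise supremum of all pseudodistances below \<^const>\<open>lempert\<close> is again such a
  pseudodistance, hence the largest one; see \<open>kobayashi_largest\<close>.  Points in different connected
  components of \<open>D\<close> are at distance \<open>\<infinity>\<close>; see \<open>kobayashi_components\<close>.
\<close>

definition kobayashi :: "(complex ^ 'n) set \<Rightarrow> complex ^ 'n \<Rightarrow> complex ^ 'n \<Rightarrow> ennreal" where
  "kobayashi D z w = (SUP d \<in> {d. pseudodistance_on D d \<and> below_lempert D d}. d z w)"

lemma kobayashi_largest:
  shows "pseudodistance_on D (kobayashi D)"
    and "below_lempert D (kobayashi D)"
    and "\<lbrakk>pseudodistance_on D d; below_lempert D d\<rbrakk> \<Longrightarrow> d z w \<le> kobayashi D z w"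
proof -
  show le: "d z w \<le> kobayashi D z w" if "pseudodistance_on D d" "below_lempert D d" for d z w
    unfolding kobayashi_def using that by (auto intro!: SUP_upper)
  show "below_lempert D (kobayashi D)"
    unfolding below_lempert_def kobayashi_def by (auto intro!: SUP_least)
  have "kobayashi D x x = 0" if "x \<in> D" for x
  proof -
    have "kobayashi D x x \<le> 0"
      unfolding kobayashi_def using that
      by (intro SUP_least) (auto simp: pseudodistance_on_def)
    then show ?thesis by simp
  qed
  moreover have "kobayashi D x y = kobayashi D y x" if "x \<in> D" "y \<in> D" for x y
    unfolding kobayashi_def using that
    by (intro SUP_cong) (auto simp: pseudodistance_on_def)
  moreover have "kobayashi D x z \<le> kobayashi D x y + kobayashi D y z"
    if "x \<in> D" "y \<in> D" "z \<in> D" for x y z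
  proof -
    have "d x z \<le> kobayashi D x y + kobayashi D y z"
      if d: "pseudodistance_on D d" "below_lempert D d" for d
    proof -
      have "d x z \<le> d x y + d y z"
        using d(1) \<open>x \<in> D\<close> \<open>y \<in> D\<close> \<open>z \<in> D\<close> by (simp add: pseudodistance_on_def)
      also have "\<dots> \<le> kobayashi D x y + kobayashi D y z"
        by (intro add_mono le d)
      finally show ?thesis .
    qed
    then show ?thesis
      unfolding kobayashi_def[of D x z] by (auto intro!: SUP_least)
  qed
  ultimately show "pseudodistance_on D (kobayashi D)"
    unfolding pseudodistance_on_def by blast
qed

lemma kobayashi_components:
  assumes "z \<in> D" "w \<in> D" "connected_component_set D z \<noteq> connected_component_set D w"
  shows "kobayashi D z w = \<infinity>"
proof -
  define d where
    "d = (\<lambda>x y. if connected_component_set D x = connected_component_set D y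
                then 0 else (\<infinity>::ennreal))"
  have same: "connected_component_set D x = connected_component_set D y"
    if f: "holomorphic_disc D f" "f 0 = x" "f l = y" "l \<in> ball 0 1" for f x y l
  proof -
    have "continuous_on (ball 0 1) (\<lambda>t. \<chi> i. f t $ i)"
      using f(1) unfolding holomorphic_disc_def
      by (intro continuous_on_vec_lambda) (auto intro: holomorphic_on_imp_continuous_on)
    then have "connected (f ` ball 0 1)"
      by (auto intro!: connected_continuous_image simp: vec_lambda_eta)
    moreover have "f ` ball 0 1 \<subseteq> D" using f(1) by (simp add: holomorphic_disc_def)
    moreover have "x \<in> f ` ball 0 1" "y \<in> f ` ball 0 1" using f(2-4) by force+
    ultimately have "connected_component D x y"
      unfolding connected_component_def by blast
    then show ?thesis by (simp add: connected_component_eq)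
  qed
  have "below_lempert D d"
    unfolding below_lempert_def lempert_def d_def
    by (auto intro!: Inf_greatest dest: same)
  moreover have "pseudodistance_on D d"
    unfolding pseudodistance_on_def d_def by auto
  ultimately have "d z w \<le> kobayashi D z w"
    by (intro kobayashi_largest(3))
  then show ?thesis using assms(3) by (simp add: d_def top_unique)
qed

definition kobayashi_ball :: "(complex ^ 'n) set \<Rightarrow> complex ^ 'n \<Rightarrow> real \<Rightarrow> (complex ^ 'n) set" where
  "kobayashi_ball D z r = {w \<in> D. kobayashi D z w < ennreal r}"

text \<open>
  All values \<open>tanh r\<close> lie in \<open>(0, 1)\<close>; the inserted \<open>0\<close> only serves to make the supremum of the
  empty set \<open>0\<close>.
\<close>

definition fridman :: "(complex ^ 'n) set \<Rightarrow> complex ^ 'n \<Rightarrow> real" where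
  "fridman D z =
     Sup (insert 0 {tanh r | r f. r > 0 \<and> kobayashi_ball D z r \<subseteq> f ` ball (0 :: complex ^ 'n) 1 \<and>
            holomorphic_map_on (ball 0 1) D f \<and> inj_on f (ball 0 1)})"

definition local_holomorphic_peak_point :: "(complex ^ 'n) set \<Rightarrow> complex ^ 'n \<Rightarrow> bool" where
  "local_holomorphic_peak_point D p \<longleftrightarrow> p \<in> frontier D \<and>
     (\<exists>W f. open W \<and> p \<in> W \<and> holomorphic_fun_on (D \<inter> W) f \<and>
        continuous_on (closure D \<inter> W) f \<and> f p = 1 \<and>
        (\<forall>z \<in> (closure D \<inter> W) - {p}. norm (f z) < 1))"

end

theory Submission
  imports Defs
begin

text \<open>
  The local peak function yields a plurisubharmonic function on all of \<open>D\<close> that is bounded above and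
  has a logarithmic pole at a given point near \<open>p\<^sub>0\<close>. By the maximum principle, every holomorphic
  disc in \<open>D\<close> centred near \<open>p\<^sub>0\<close> maps a smaller disc, of a radius independent of the given one, into
  a fixed ball around \<open>p\<^sub>0\<close> contained in \<open>U\<close>. In that ball the peak function forces Kobayashi balls
  of bounded radius to shrink to \<open>p\<^sub>0\<close> as their centre \<open>z\<close> does. Together these give, for every \<open>R\<close>, a
  \<open>C\<close> such that the Kobayashi ball of radius \<open>R\<close> about \<open>z\<close> in \<open>D\<close> lies in that of radius \<open>C\<close> in
  \<open>D \<inter> U\<close> for all \<open>z\<close> near \<open>p\<^sub>0\<close>. Because the invariant of \<open>D \<inter> U\<close> tends to \<open>1\<close>, any such \<open>C\<close> is
  good enough.
\<close>

unbundle no fps_syntax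

section \<open>Supporting holomorphic functions and the maximum principle\<close>

text \<open>A multiplicative form of log-subharmonicity: \<open>\<Phi>\<close> is touched from below at \<open>z\<close> by the
  modulus of a holomorphic function. This suffices for the maximum principle and is stable under
  products and maxima, so no theory of subharmonic functions is needed.\<close>

definition holo_support_at :: "(complex \<Rightarrow> real) \<Rightarrow> complex \<Rightarrow> bool" where
  "holo_support_at \<Phi> z \<longleftrightarrow>
     (\<exists>h e. e > 0 \<and> h holomorphic_on ball z e \<and> (\<forall>w\<in>ball z e. norm (h w) \<le> \<Phi> w) \<and> norm (h z) = \<Phi> z)"

lemma holo_support_atI:
  assumes "e > 0" "h holomorphic_on ball z e" "\<And>w. w \<in> ball z e \<Longrightarrow> norm (h w) \<le> \<Phi> w"
    "norm (h z) = \<Phi> z"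
  shows "holo_support_at \<Phi> z"
  using assms unfolding holo_support_at_def by blast

text \<open>The gluing tool: at each point some branch of a glued function attains its value and
  stays below it nearby, so the support of that branch serves for the whole.\<close>

lemma holo_support_at_mono:
  assumes "holo_support_at \<Psi> z" "\<Phi> z = \<Psi> z" "eventually (\<lambda>w. \<Psi> w \<le> \<Phi> w) (nhds z)"
  shows "holo_support_at \<Phi> z"
proof -
  obtain h e where he: "e > 0" "h holomorphic_on ball z e" "\<forall>w\<in>ball z e. norm (h w) \<le> \<Psi> w"
    "norm (h z) = \<Psi> z"
    using assms(1) unfolding holo_support_at_def by blast
  obtain d where d: "d > 0" "\<And>w. dist w z < d \<Longrightarrow> \<Psi> w \<le> \<Phi> w"
    using assms(3) unfolding eventually_nhds_metric by blast
  show ?thesis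
  proof (rule holo_support_atI)
    show "min d e > 0" using d he by simp
    show "h holomorphic_on ball z (min d e)"
      using he(2) by (rule holomorphic_on_subset) auto
    fix w assume "w \<in> ball z (min d e)"
    then show "norm (h w) \<le> \<Phi> w"
      using he(3) d(2)[of w] order_trans[of "norm (h w)" "\<Psi> w"] by (simp add: dist_commute)
  qed (use he assms in simp)
qed

lemma holo_support_at_mult:
  assumes "holo_support_at \<Phi> z" "holo_support_at \<Psi> z"
  shows "holo_support_at (\<lambda>w. \<Phi> w * \<Psi> w) z"
proof -
  obtain h e where he: "e > 0" "h holomorphic_on ball z e" "\<forall>w\<in>ball z e. norm (h w) \<le> \<Phi> w"
    "norm (h z) = \<Phi> z"
    using assms(1) unfolding holo_support_at_def by blast
  obtain k d where kd: "d > 0" "k holomorphic_on ball z d" "\<forall>w\<in>ball z d. norm (k w) \<le> \<Psi> w"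
    "norm (k z) = \<Psi> z"
    using assms(2) unfolding holo_support_at_def by blast
  show ?thesis
  proof (rule holo_support_atI)
    show "min d e > 0" using kd he by simp
    have "h holomorphic_on ball z (min d e)" "k holomorphic_on ball z (min d e)"
      using he(2) kd(2) by (auto intro: holomorphic_on_subset)
    then show "(\<lambda>w. h w * k w) holomorphic_on ball z (min d e)"
      by (rule holomorphic_on_mult)
    fix w assume "w \<in> ball z (min d e)"
    then have "norm (h w) \<le> \<Phi> w" "norm (k w) \<le> \<Psi> w" using he kd by auto
    then show "norm (h w * k w) \<le> \<Phi> w * \<Psi> w"
      unfolding norm_mult by (rule mult_mono) (use \<open>norm (h w) \<le> \<Phi> w\<close> norm_ge_zero order_trans in blast, simp)
  qed (use he kd in \<open>simp add: norm_mult\<close>)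
qed

lemma holo_support_at_norm:
  assumes "h holomorphic_on S" "open S" "z \<in> S"
  shows "holo_support_at (\<lambda>w. norm (h w)) z"
proof -
  obtain e where "e > 0" "ball z e \<subseteq> S" using assms by (meson openE)
  then show ?thesis
    using holo_support_atI[of e h z "\<lambda>w. norm (h w)"] assms(1) holomorphic_on_subset by blast
qed

lemma holo_support_at_const: "c \<ge> 0 \<Longrightarrow> holo_support_at (\<lambda>w. c) z"
  by (rule holo_support_atI[of 1 "\<lambda>_. of_real c"]) auto

lemma holo_support_at_power:
  assumes "holo_support_at \<Phi> z" shows "holo_support_at (\<lambda>w. \<Phi> w ^ n) z"
  by (induction n) (auto intro: holo_support_at_const holo_support_at_mult assms)

lemma norm_sum_cnj_le:
  fixes x y :: "complex ^ 'n"
  shows "norm (\<Sum>i\<in>UNIV. x $ i * cnj (y $ i)) \<le> norm x * norm y"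
proof -
  have "norm (\<Sum>i\<in>UNIV. x $ i * cnj (y $ i)) \<le> (\<Sum>i\<in>UNIV. \<bar>norm (x $ i)\<bar> * \<bar>norm (y $ i)\<bar>)"
    by (rule order_trans[OF norm_sum]) (simp add: norm_mult)
  also have "\<dots> \<le> norm x * norm y"
    unfolding norm_vec_def by (rule L2_set_mult_ineq)
  finally show ?thesis .
qed

lemma sum_cnj_self:
  fixes x :: "complex ^ 'n"
  shows "(\<Sum>i\<in>UNIV. x $ i * cnj (x $ i)) = of_real ((norm x)\<^sup>2)"
proof -
  have "(norm x)\<^sup>2 = (\<Sum>i\<in>UNIV. (norm (x $ i))\<^sup>2)"
    by (simp add: norm_vec_def L2_set_def sum_nonneg)
  then show ?thesis by (simp add: complex_norm_square[symmetric])
qed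

text \<open>Pair \<open>g w\<close> with the unit vector in the direction of \<open>g z\<close>.
  This is holomorphic in \<open>w\<close>, since only the fixed vector is conjugated; Cauchy-Schwarz
  bounds it by \<open>norm (g w)\<close>, with equality at \<open>z\<close>.\<close>

lemma holo_support_at_norm_vec:
  fixes g :: "complex \<Rightarrow> complex ^ 'n"
  assumes g: "\<And>i. (\<lambda>w. g w $ i) holomorphic_on S" and S: "open S" "z \<in> S"
  shows "holo_support_at (\<lambda>w. norm (g w)) z"
proof (cases "g z = 0")
  case True
  then show ?thesis by (intro holo_support_atI[of 1 "\<lambda>_. 0"]) auto
next
  case False
  obtain e where e: "e > 0" "ball z e \<subseteq> S" using S by (meson openE)
  define h where "h = (\<lambda>w. (\<Sum>i\<in>UNIV. g w $ i * cnj (g z $ i)) / of_real (norm (g z)))"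
  show ?thesis
  proof (rule holo_support_atI[OF e(1)])
    show "h holomorphic_on ball z e"
      unfolding h_def using False e g by (auto intro!: holomorphic_intros intro: holomorphic_on_subset)
    show "norm (h w) \<le> norm (g w)" if "w \<in> ball z e" for w
      using norm_sum_cnj_le[of "g w" "g z"] False by (simp add: h_def norm_divide field_simps)
    show "norm (h z) = norm (g z)"
      using False by (simp add: h_def sum_cnj_self norm_divide power2_eq_square)
  qed
qed

lemma one_plus_mult_square_le:
  fixes a b \<epsilon> :: real
  assumes "\<epsilon> \<ge> 0"
  shows "(1 + \<epsilon> * (a * b))\<^sup>2 \<le> (1 + \<epsilon> * a\<^sup>2) * (1 + \<epsilon> * b\<^sup>2)"
proof -
  have "(1 + \<epsilon> * a\<^sup>2) * (1 + \<epsilon> * b\<^sup>2) - (1 + \<epsilon> * (a * b))\<^sup>2 = \<epsilon> * (a - b)\<^sup>2"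
    by (simp add: power2_eq_square algebra_simps)
  then show ?thesis using assms by (smt (verit) mult_nonneg_nonneg zero_le_power2)
qed

text \<open>The function is the squared norm of the vector
  \<open>(1, sqrt \<epsilon> * g w)\<close>. Its pairing with the value at \<open>z\<close>, squared
  and divided by \<open>B\<close>, is the support; the bound is again Cauchy-Schwarz.\<close>

lemma holo_support_at_one_plus_norm_square:
  fixes g :: "complex \<Rightarrow> complex ^ 'n"
  assumes g: "\<And>i. (\<lambda>w. g w $ i) holomorphic_on S" and S: "open S" "z \<in> S" and \<epsilon>: "\<epsilon> \<ge> 0"
  shows "holo_support_at (\<lambda>w. 1 + \<epsilon> * (norm (g w))\<^sup>2) z"
proof -
  obtain e where e: "e > 0" "ball z e \<subseteq> S" using S by (meson openE)
  define B where "B = 1 + \<epsilon> * (norm (g z))\<^sup>2"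
  have B: "B > 0" unfolding B_def using \<epsilon> by (simp add: add_pos_nonneg)
  define h where "h = (\<lambda>w. (1 + of_real \<epsilon> * (\<Sum>i\<in>UNIV. g w $ i * cnj (g z $ i)))\<^sup>2 / of_real B)"
  show ?thesis
  proof (rule holo_support_atI[OF e(1)])
    show "h holomorphic_on ball z e"
      unfolding h_def using B e g by (auto intro!: holomorphic_intros intro: holomorphic_on_subset)
    show "norm (h w) \<le> 1 + \<epsilon> * (norm (g w))\<^sup>2" if "w \<in> ball z e" for w
    proof -
      let ?s = "(\<Sum>i\<in>UNIV. g w $ i * cnj (g z $ i))"
      have "norm (1 + of_real \<epsilon> * ?s) \<le> 1 + norm (of_real \<epsilon> * ?s)"
        using norm_triangle_ineq[of 1 "of_real \<epsilon> * ?s"] by simp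
      also have "\<dots> \<le> 1 + \<epsilon> * (norm (g w) * norm (g z))"
        using \<epsilon> norm_sum_cnj_le[of "g w" "g z"] by (simp add: norm_mult mult_left_mono)
      finally have "(norm (1 + of_real \<epsilon> * ?s))\<^sup>2 \<le> (1 + \<epsilon> * (norm (g w) * norm (g z)))\<^sup>2"
        by (rule power_mono) simp
      also have "\<dots> \<le> (1 + \<epsilon> * (norm (g w))\<^sup>2) * B"
        unfolding B_def by (rule one_plus_mult_square_le[OF \<epsilon>])
      finally show ?thesis
        using B by (simp add: h_def norm_divide norm_power field_simps)
    qed
    have "1 + of_real \<epsilon> * of_real ((norm (g z))\<^sup>2) = (of_real B :: complex)" by (simp add: B_def)
    then have "h z = of_real B"
      unfolding h_def sum_cnj_self using B by (simp add: power2_eq_square)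
    then show "norm (h z) = 1 + \<epsilon> * (norm (g z))\<^sup>2"
      using B unfolding B_def[symmetric] by (simp only: norm_of_real)
  qed
qed

text \<open>Among the maximum points in the closed disc take one farthest from the origin. If it were
  interior, the supporting holomorphic function would be locally constant and all nearby points
  would be maximum points too.\<close>

lemma holo_support_max_principle:
  fixes \<Phi> :: "complex \<Rightarrow> real"
  assumes t: "t \<ge> 0" and cont: "continuous_on (cball 0 t) \<Phi>"
    and supp: "\<And>z. norm z < t \<Longrightarrow> holo_support_at \<Phi> z"
    and bd: "\<And>z. norm z = t \<Longrightarrow> \<Phi> z \<le> K"
    and z: "norm z \<le> t"
  shows "\<Phi> z \<le> K"
proof -
  obtain m where m: "m \<in> cball 0 t" "\<And>w. w \<in> cball 0 t \<Longrightarrow> \<Phi> w \<le> \<Phi> m"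
    using continuous_attains_sup[OF compact_cball _ cont] t by auto
  define A where "A = cball 0 t \<inter> \<Phi> -` {\<Phi> m}"
  have "closed A"
    unfolding A_def by (rule continuous_closed_preimage[OF cont]) auto
  then have "compact A"
    using bounded_subset[of "cball (0::complex) t" A] by (auto simp: A_def compact_eq_bounded_closed)
  moreover have "m \<in> A" using m by (simp add: A_def)
  ultimately obtain a where a: "a \<in> A" "\<And>w. w \<in> A \<Longrightarrow> norm w \<le> norm a"
    using continuous_attains_sup[of A norm] by (auto intro: continuous_intros)
  have "norm a = t"
  proof (rule ccontr)
    assume "norm a \<noteq> t"
    then have at: "norm a < t" using a by (simp add: A_def)
    obtain h e where he: "e > 0" "h holomorphic_on ball a e"
      "\<And>w. w \<in> ball a e \<Longrightarrow> norm (h w) \<le> \<Phi> w" "norm (h a) = \<Phi> a"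
      using supp[OF at] unfolding holo_support_at_def by blast
    define d where "d = min e (t - norm a)"
    have d: "d > 0" "ball a d \<subseteq> ball a e" using he at by (auto simp: d_def)
    have sub: "w \<in> cball 0 t" if "w \<in> ball a d" for w
    proof -
      have "norm w \<le> norm a + norm (w - a)" using norm_triangle_ineq[of a "w - a"] by simp
      then show ?thesis using that by (simp add: d_def dist_norm norm_minus_commute)
    qed
    have a\<Phi>: "\<Phi> a = \<Phi> m" using a by (simp add: A_def)
    have "h constant_on ball a d"
    proof (rule maximum_modulus_principle[where U = "ball a d" and \<xi> = a])
      show "h holomorphic_on ball a d" using he(2) d(2) by (rule holomorphic_on_subset)
      fix w assume w: "w \<in> ball a d"
      then show "norm (h w) \<le> norm (h a)"
        using he(3)[of w] m(2)[OF sub[OF w]] d(2) he(4) a\<Phi> by auto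
    qed (use d in auto)
    then have const: "h w = h a" if "w \<in> ball a d" for w
      using that d(1) unfolding constant_on_def by (metis centre_in_ball)
    \<comment> \<open>\<open>w\<close> is \<open>a\<close> pushed radially outward by
      \<open>d/2\<close>, contradicting that \<open>a\<close> is farthest out. For
      \<open>a = 0\<close> any unit direction will do, and \<open>sgn 0 = 0\<close> is not
      one.\<close>
    define u where "u = (if a = 0 then 1 else sgn a)"
    have u: "norm u = 1" by (simp add: u_def norm_sgn)
    define w where "w = a + of_real (d/2) * u"
    have wb: "w \<in> ball a d" using d u by (simp add: w_def dist_norm norm_mult)
    have "a = of_real (norm a) * u" by (simp add: u_def sgn_eq)
    then have "w = of_real (norm a + d/2) * u" by (metis w_def distrib_right of_real_add)
    then have nw: "norm w = norm a + d/2" using u d by (simp add: norm_mult del: of_real_add)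
    have "\<Phi> m \<le> \<Phi> w" using he(3)[of w] const[OF wb] he(4) a\<Phi> wb d(2) by auto
    then have "w \<in> A" using m(2)[OF sub[OF wb]] sub[OF wb] by (auto simp: A_def)
    then show False using a(2)[of w] nw d(1) by simp
  qed
  then have "\<Phi> m \<le> K" using bd[of a] a by (simp add: A_def)
  then show ?thesis using m(2)[of z] z by simp
qed

section \<open>Holomorphic functions along discs\<close>

text \<open>Chain rule: the curve has derivative \<open>h *s v\<close>, and complex linearity of
  \<open>f'\<close> turns \<open>f' (h *s v)\<close> into multiplication by the number
  \<open>f' v\<close>.\<close>

lemma holomorphic_fun_on_compose_curve:
  fixes \<phi> :: "complex \<Rightarrow> complex ^ 'n"
  assumes f: "holomorphic_fun_on S f" and S: "open S" and T: "open T"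
    and \<phi>: "\<And>i. (\<lambda>\<zeta>. \<phi> \<zeta> $ i) holomorphic_on T" and sub: "\<phi> ` T \<subseteq> S"
  shows "(\<lambda>\<zeta>. f (\<phi> \<zeta>)) holomorphic_on T"
  unfolding holomorphic_on_open[OF T]
proof
  fix \<zeta> assume \<zeta>: "\<zeta> \<in> T"
  define v where "v = (\<chi> i. deriv (\<lambda>\<zeta>. \<phi> \<zeta> $ i) \<zeta>)"
  have "((\<lambda>\<zeta>. \<phi> \<zeta> $ i) has_derivative (\<lambda>h. (h *s v) $ i)) (at \<zeta>)" for i
    using holomorphic_derivI[OF \<phi>[of i] T \<zeta>]
    by (auto simp: has_field_derivative_def v_def mult.commute[of _ "deriv _ _"] fun_eq_iff elim!: has_derivative_eq_rhs)
  then have 1: "(\<phi> has_derivative (\<lambda>h. h *s v)) (at \<zeta>)"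
    unfolding has_derivative_componentwise_within[of \<phi>] Basis_vec_def
    by (auto simp: inner_axis simp del: vector_smult_component intro!: has_derivative_inner_left)
  have "\<phi> \<zeta> \<in> S" using sub \<zeta> by auto
  then obtain f' where f': "(f has_derivative f') (at (\<phi> \<zeta>))" "\<And>c v. f' (c *s v) = c * f' v"
    using f S unfolding holomorphic_fun_on_def by (metis at_within_open)
  have "((\<lambda>\<zeta>. f (\<phi> \<zeta>)) has_derivative (\<lambda>h. f' (h *s v))) (at \<zeta>)"
    by (rule has_derivative_compose[OF 1 f'(1)])
  then have "((\<lambda>\<zeta>. f (\<phi> \<zeta>)) has_field_derivative f' v) (at \<zeta>)"
    unfolding has_field_derivative_def f'(2) by (rule has_derivative_eq_rhs) (simp add: fun_eq_iff mult.commute)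
  then show "\<exists>f'. ((\<lambda>\<zeta>. f (\<phi> \<zeta>)) has_field_derivative f') (at \<zeta>)" by blast
qed

lemma holomorphic_disc_continuous:
  assumes "holomorphic_disc D \<phi>"
  shows "continuous_on (ball 0 1) \<phi>"
proof -
  have "continuous_on (ball 0 1) (\<lambda>t. \<chi> i. \<phi> t $ i)"
    using assms unfolding holomorphic_disc_def
    by (intro continuous_on_vec_lambda) (auto intro: holomorphic_on_imp_continuous_on)
  then show ?thesis by (simp add: vec_lambda_eta)
qed

section \<open>Localization of discs near a peak point\<close>

text \<open>The neighborhood of the peak function is shrunk to a ball whose closure still carries
  continuity and the strict bound, so that extrema over compact parts of
  \<open>closure D \<inter> cball p \<rho>\<close> exist.\<close>

locale peak_function =
  fixes D :: "(complex ^ 'n) set" and p :: "complex ^ 'n" and f :: "complex ^ 'n \<Rightarrow> complex"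
    and \<rho> :: real
  assumes open_D: "open D" and p_closure: "p \<in> closure D" and p_notin: "p \<notin> D"
    and \<rho>_pos: "\<rho> > 0"
    and holo_f: "holomorphic_fun_on (D \<inter> ball p \<rho>) f"
    and cont_f: "continuous_on (closure D \<inter> cball p \<rho>) f"
    and f_p: "f p = 1"
    and f_less: "\<And>x. x \<in> closure D \<Longrightarrow> norm (x - p) \<le> \<rho> \<Longrightarrow> x \<noteq> p \<Longrightarrow> norm (f x) < 1"
begin

text \<open>By compactness \<open>norm (f x)\<close> stays below some \<open>m < 1\<close> on the
  sphere of radius \<open>\<rho>\<close>, while it is close to 1 near \<open>p\<close>. The level
  \<open>c\<close> separates the two, and \<open>\<epsilon>\<close> is small enough to respect the
  gap between \<open>m\<close> and \<open>c\<close>.\<close>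

lemma separation_constants:
  obtains c \<epsilon> \<rho>2 where "0 < c" "c < 1" "0 < \<epsilon>" "0 < \<rho>2" "\<rho>2 < \<rho>"
    "\<And>x. x \<in> closure D \<Longrightarrow> norm (x - p) = \<rho> \<Longrightarrow> norm (f x) * (1 + \<epsilon> * \<rho>\<^sup>2) \<le> c"
    "\<And>x. x \<in> closure D \<Longrightarrow> norm (x - p) \<le> \<rho>2 \<Longrightarrow> c < norm (f x)"
proof -
  define K where "K = closure D \<inter> sphere p \<rho>"
  have "\<exists>m. 0 \<le> m \<and> m < 1 \<and> (\<forall>x\<in>K. norm (f x) \<le> m)"
  proof (cases "K = {}")
    case True
    then show ?thesis by (intro exI[of _ 0]) auto
  next
    case False
    have "compact K" unfolding K_def by (auto intro: closed_Int_compact)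
    moreover have "continuous_on K (\<lambda>x. norm (f x))"
      using cont_f by (auto intro!: continuous_on_norm intro: continuous_on_subset simp: K_def)
    ultimately obtain x where "x \<in> K" "\<And>y. y \<in> K \<Longrightarrow> norm (f y) \<le> norm (f x)"
      using continuous_attains_sup False by metis
    moreover from \<open>x \<in> K\<close> have "norm (f x) < 1"
      using \<rho>_pos by (intro f_less) (auto simp: K_def dist_norm norm_minus_commute)
    ultimately show ?thesis by (intro exI[of _ "norm (f x)"]) auto
  qed
  then obtain m where m: "0 \<le> m" "m < 1" "\<And>x. x \<in> K \<Longrightarrow> norm (f x) \<le> m" by auto
  define c where "c = (1 + m) / 2"
  have c: "0 < c" "c < 1" "m < c" using m by (auto simp: c_def)
  define \<epsilon> where "\<epsilon> = (c - m) / \<rho>\<^sup>2"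
  have \<epsilon>: "\<epsilon> > 0" "\<epsilon> * \<rho>\<^sup>2 = c - m" using c \<rho>_pos by (auto simp: \<epsilon>_def)
  have bd: "norm (f x) * (1 + \<epsilon> * \<rho>\<^sup>2) \<le> c" if "x \<in> closure D" "norm (x - p) = \<rho>" for x
  proof -
    have "norm (f x) \<le> m"
      using that by (intro m(3)) (auto simp: K_def dist_norm norm_minus_commute)
    then have "norm (f x) * (1 + \<epsilon> * \<rho>\<^sup>2) \<le> m * (1 + \<epsilon> * \<rho>\<^sup>2)"
      using \<epsilon> c by (intro mult_right_mono) auto
    also have "\<dots> = m * (1 + c - m)" unfolding \<epsilon>(2) by (simp add: algebra_simps)
    also have "\<dots> \<le> c"
    proof -
      have "c - m * (1 + c - m) = (c - m) * (1 - m)" by (simp add: algebra_simps)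
      then show ?thesis using c m by (smt (verit) mult_nonneg_nonneg)
    qed
    finally show ?thesis .
  qed
  obtain d where d: "d > 0"
    "\<And>x. x \<in> closure D \<inter> cball p \<rho> \<Longrightarrow> dist x p < d \<Longrightarrow> dist (f x) (f p) < 1 - c"
    using cont_f c p_closure \<rho>_pos unfolding continuous_on_iff
    by (metis IntI centre_in_cball diff_gt_0_iff_gt less_eq_real_def)
  define \<rho>2 where "\<rho>2 = min (d / 2) (\<rho> / 2)"
  have \<rho>2: "\<rho>2 > 0" "\<rho>2 < \<rho>" "\<rho>2 < d" using d \<rho>_pos by (auto simp: \<rho>2_def)
  have "c < norm (f x)" if "x \<in> closure D" "norm (x - p) \<le> \<rho>2" for x
  proof -
    have "dist (f x) 1 < 1 - c"
      using d(2)[of x] that \<rho>2 f_p by (auto simp: dist_norm norm_minus_commute)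
    then show ?thesis using norm_triangle_ineq2[of 1 "f x"] by (simp add: dist_norm norm_minus_commute)
  qed
  then show thesis using that[of c \<epsilon> \<rho>2] c \<epsilon> \<rho>2 bd by blast
qed

text \<open>The function \<open>\<Phi>\<close> below is \<open>\<zeta> \<mapsto> G (\<phi> \<zeta>) / norm \<zeta>\<close> where \<open>log G\<close> is a bounded-above
  plurisubharmonic function on \<open>D\<close> with a logarithmic pole at \<open>\<phi> 0\<close>. It is obtained by gluing
  \<open>b * norm (x - \<phi> 0) * norm (f x) ^ A\<close> near \<open>p\<close> to
  \<open>(norm (f x) * (1 + \<epsilon> * (norm (x - p))\<^sup>2)) ^ A\<close> farther away, and the latter to
  the constant \<open>c ^ A\<close>.  For \<open>A\<close> large, the factor with \<open>\<epsilon>\<close> makes up for the growth of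
  \<open>norm (x - \<phi> 0)\<close>.\<close>

lemma disc_localization:
  obtains \<rho>1 r0 where "0 < \<rho>1" "\<rho>1 < \<rho>" "0 < r0" "r0 < 1"
    "\<And>\<phi> \<zeta>. holomorphic_disc D \<phi> \<Longrightarrow> norm (\<phi> 0 - p) < \<rho>1 / 2 \<Longrightarrow> norm \<zeta> < r0 \<Longrightarrow>
       norm (\<phi> \<zeta> - p) < \<rho>"
proof -
  obtain c \<epsilon> \<rho>2 where c: "0 < c" "c < 1" and \<epsilon>: "0 < \<epsilon>" and \<rho>2: "0 < \<rho>2" "\<rho>2 < \<rho>"
    and f_outer: "\<And>x. x \<in> closure D \<Longrightarrow> norm (x - p) = \<rho> \<Longrightarrow> norm (f x) * (1 + \<epsilon> * \<rho>\<^sup>2) \<le> c"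
    and f_inner: "\<And>x. x \<in> closure D \<Longrightarrow> norm (x - p) \<le> \<rho>2 \<Longrightarrow> c < norm (f x)"
    by (rule separation_constants) blast
  define \<rho>1 where "\<rho>1 = \<rho>2 / 2"
  have \<rho>1: "0 < \<rho>1" "\<rho>1 < \<rho>2" "\<rho>2 = 2 * \<rho>1" using \<rho>2 by (auto simp: \<rho>1_def)
  define E where "E = (\<lambda>s. 1 + \<epsilon> * s\<^sup>2)"
  have E: "1 \<le> E s" "0 < E s" for s
    using \<epsilon> by (auto simp: E_def intro: add_pos_nonneg)
  have E_mono: "E s \<le> E t" if "0 \<le> s" "s \<le> t" for s t
    using \<epsilon> that by (auto simp: E_def intro!: mult_left_mono power_mono)
  have "E \<rho>1 < E \<rho>2"
    using \<epsilon> \<rho>1 by (auto simp: E_def intro!: mult_strict_left_mono power_strict_mono)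
  then have "1 < E \<rho>2 / E \<rho>1" using E(2)[of \<rho>1] by simp
  \<comment> \<open>The 8 is what \<open>glue2\<close> requires: as
    \<open>\<rho>2 = 2 * \<rho>1\<close>, the constant \<open>b\<close> below satisfies
    \<open>b * (2 * \<rho>2) = 8 * E \<rho>1 ^ A\<close>.\<close>
  then obtain A where "8 < (E \<rho>2 / E \<rho>1) ^ A" using real_arch_pow by blast
  then have A: "8 * E \<rho>1 ^ A \<le> E \<rho>2 ^ A" using E(2)[of \<rho>1] by (simp add: power_divide field_simps)
  \<comment> \<open>Where \<open>n \<zeta> = \<rho>1\<close>, the distance from
    \<open>\<phi> \<zeta>\<close> to \<open>\<phi> 0\<close> exceeds \<open>\<rho>1 / 2\<close>;
    \<open>b\<close> is scaled so that the inner branch then dominates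
    \<open>E \<rho>1 ^ A\<close>.\<close>
  define b where "b = 2 * E \<rho>1 ^ A / \<rho>1"
  have b: "b > 0" using E(2)[of \<rho>1] \<rho>1 by (auto simp: b_def)
  have b1: "b * (\<rho>1 / 2) = E \<rho>1 ^ A" using \<rho>1 by (simp add: b_def)
  have b2: "b * (2 * \<rho>2) \<le> E \<rho>2 ^ A" using \<rho>1 A by (simp add: b_def)
  define K where "K = E \<rho> ^ A"
  have K: "K \<ge> 1" using E(1)[of \<rho>] by (simp add: K_def one_le_power)
  \<comment> \<open>The maximum principle will give \<open>\<Phi> \<le> 2 * K\<close> on the disc of
    radius 1/2, whereas \<open>\<Phi>\<close> is at least \<open>c ^ A / norm \<zeta>\<close>
    wherever the disc has left the ball of radius \<open>\<rho>\<close>; below radius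
    \<open>r0\<close> these conflict.\<close>
  define r0 where "r0 = c ^ A / (2 * K)"
  have cA: "0 < c ^ A" "c ^ A \<le> 1" using c by (auto intro: power_le_one)
  have r0: "0 < r0" "r0 \<le> 1 / 2" using K cA by (auto simp: r0_def field_simps)
  have main: "norm (\<phi> \<zeta>0 - p) < \<rho>"
    if \<phi>: "holomorphic_disc D \<phi>" "norm (\<phi> 0 - p) < \<rho>1 / 2" and \<zeta>0: "norm \<zeta>0 < r0" for \<phi> \<zeta>0
  proof -
    have \<phi>_holo: "(\<lambda>\<zeta>. \<phi> \<zeta> $ i) holomorphic_on ball 0 1" for i
      using \<phi>(1) by (simp add: holomorphic_disc_def)
    have \<phi>_D: "\<phi> \<zeta> \<in> D" if "norm \<zeta> < 1" for \<zeta>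
      using \<phi>(1) that by (auto simp: holomorphic_disc_def)
    have \<phi>_cont: "continuous_on (ball 0 1) \<phi>" by (rule holomorphic_disc_continuous[OF \<phi>(1)])
    \<comment> \<open>Dividing out the zero at the origin makes \<open>\<Phi>1\<close>, which
      contains the factor \<open>1 / norm \<zeta>\<close> implicitly, regular at 0.\<close>
    have "\<exists>h. h holomorphic_on ball 0 1 \<and> (\<forall>\<zeta>. norm \<zeta> < 1 \<longrightarrow> \<phi> \<zeta> $ i - \<phi> 0 $ i = \<zeta> * h \<zeta>)" for i
    proof -
      have "(\<lambda>\<zeta>. \<phi> \<zeta> $ i - \<phi> 0 $ i) holomorphic_on ball 0 1"
        by (intro holomorphic_intros \<phi>_holo)
      then show ?thesis by (rule Schwarz3) auto
    qed
    then obtain h where h: "\<And>i. h i holomorphic_on ball 0 1"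
      "\<And>i \<zeta>. norm \<zeta> < 1 \<Longrightarrow> \<phi> \<zeta> $ i - \<phi> 0 $ i = \<zeta> * h i \<zeta>"
      by metis
    define G where "G = (\<lambda>\<zeta>. \<chi> i. h i \<zeta>)"
    have G: "norm (\<phi> \<zeta> - \<phi> 0) = norm \<zeta> * norm (G \<zeta>)" if "norm \<zeta> < 1" for \<zeta>
    proof -
      have "\<phi> \<zeta> - \<phi> 0 = \<zeta> *s G \<zeta>" using h(2)[OF that] by (simp add: vec_eq_iff G_def)
      then show ?thesis by (simp add: norm_vec_def norm_mult L2_set_right_distrib)
    qed
    have G_cont: "continuous_on (ball 0 1) G"
      unfolding G_def by (intro continuous_on_vec_lambda holomorphic_on_imp_continuous_on h)
    define n where "n = (\<lambda>\<zeta>. norm (\<phi> \<zeta> - p))"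
    define u where "u = (\<lambda>\<zeta>. norm (f (\<phi> \<zeta>)))"
    define v where "v = (\<lambda>\<zeta>. u \<zeta> * E (n \<zeta>))"
    \<comment> \<open>The branches match at \<open>n \<zeta> = \<rho>\<close>, where
      \<open>v \<zeta> \<le> c\<close> by the choice of \<open>\<epsilon>\<close>. So
      \<open>H\<close> continues the peak function, as a constant, to discs leaving the
      ball.\<close>
    define H where "H = (\<lambda>\<zeta>. if n \<zeta> \<le> \<rho> then max (v \<zeta>) c else c)"
    define \<Phi>1 where "\<Phi>1 = (\<lambda>\<zeta>. b * norm (G \<zeta>) * u \<zeta> ^ A)"
    define \<Phi>2 where "\<Phi>2 = (\<lambda>\<zeta>. H \<zeta> ^ A * norm (1 / \<zeta>))"
    define \<Phi> where
      "\<Phi> = (\<lambda>\<zeta>. if n \<zeta> \<le> \<rho>1 then \<Phi>1 \<zeta> else if n \<zeta> \<le> \<rho>2 then max (\<Phi>1 \<zeta>) (\<Phi>2 \<zeta>) else \<Phi>2 \<zeta>)"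
    have n_cont: "continuous_on (ball 0 1) n"
      unfolding n_def by (intro continuous_intros \<phi>_cont)
    have n_nonneg: "n \<zeta> \<ge> 0" for \<zeta> by (simp add: n_def)
    have u_nonneg: "u \<zeta> \<ge> 0" for \<zeta> by (simp add: u_def)
    have u_less: "u \<zeta> < 1" if "norm \<zeta> < 1" "n \<zeta> \<le> \<rho>" for \<zeta>
      using f_less[of "\<phi> \<zeta>"] \<phi>_D[OF that(1)] that(2) closure_subset p_notin
      by (auto simp: u_def n_def)
    have H_inner: "c < u \<zeta>" "H \<zeta> = v \<zeta>" if "norm \<zeta> < 1" "n \<zeta> \<le> \<rho>2" for \<zeta>
    proof -
      show *: "c < u \<zeta>"
        using f_inner[of "\<phi> \<zeta>"] \<phi>_D[OF that(1)] that(2) closure_subset by (auto simp: u_def n_def)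
      have "u \<zeta> * 1 \<le> v \<zeta>"
        unfolding v_def by (intro mult_left_mono E u_nonneg)
      then show "H \<zeta> = v \<zeta>" using * that \<rho>2 by (simp add: H_def)
    qed
    have v_outer: "v \<zeta> \<le> c" if "norm \<zeta> < 1" "n \<zeta> = \<rho>" for \<zeta>
      using f_outer[of "\<phi> \<zeta>"] \<phi>_D[OF that(1)] that(2) closure_subset
      by (auto simp: v_def u_def n_def E_def)
    have H_lower: "c \<le> H \<zeta>" for \<zeta> by (simp add: H_def)
    have H_upper: "H \<zeta> \<le> E \<rho>" if "norm \<zeta> < 1" for \<zeta>
    proof -
      have "v \<zeta> \<le> 1 * E \<rho>" if "n \<zeta> \<le> \<rho>"
        unfolding v_def using u_less[OF \<open>norm \<zeta> < 1\<close> that] that E(2)[of "n \<zeta>"] n_nonneg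
        by (intro mult_mono E_mono) auto
      then show ?thesis using c E(1)[of \<rho>] by (auto simp: H_def)
    qed
    \<comment> \<open>This keeps the pole of \<open>\<Phi>2\<close> at 0 out of the region where
      \<open>\<Phi>2\<close> enters \<open>\<Phi>\<close>, since
      \<open>n 0 < \<rho>1 / 2\<close>.\<close>
    have nonzero: "\<zeta> \<noteq> 0" if "\<rho>1 \<le> n \<zeta>" for \<zeta>
      using that \<phi>(2) \<rho>1 by (auto simp: n_def)
    have \<Phi>1_eq: "\<Phi>1 \<zeta> = b * norm (\<phi> \<zeta> - \<phi> 0) * u \<zeta> ^ A * norm (1 / \<zeta>)"
      if "norm \<zeta> < 1" "\<zeta> \<noteq> 0" for \<zeta>
      using G[OF that(1)] that(2) by (simp add: \<Phi>1_def norm_divide)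
    have \<Phi>2_eq: "\<Phi>2 \<zeta> = E (n \<zeta>) ^ A * u \<zeta> ^ A * norm (1 / \<zeta>)" if "norm \<zeta> < 1" "n \<zeta> \<le> \<rho>2" for \<zeta>
      using H_inner[OF that] by (simp add: \<Phi>2_def v_def power_mult_distrib)
    \<comment> \<open>Both sides share the factor \<open>u \<zeta> ^ A * norm (1 / \<zeta>)\<close>,
      so only \<open>b * norm (\<phi> \<zeta> - \<phi> 0)\<close> and
      \<open>E (n \<zeta>) ^ A\<close> are compared; likewise in \<open>glue2\<close>.\<close>
    have glue1: "\<Phi>2 \<zeta> \<le> \<Phi>1 \<zeta>" if "norm \<zeta> < 1" "n \<zeta> = \<rho>1" for \<zeta>
    proof -
      have "n \<zeta> \<le> norm (\<phi> \<zeta> - \<phi> 0) + norm (\<phi> 0 - p)"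
        using norm_triangle_ineq[of "\<phi> \<zeta> - \<phi> 0" "\<phi> 0 - p"] by (simp add: n_def)
      then have "b * (\<rho>1 / 2) \<le> b * norm (\<phi> \<zeta> - \<phi> 0)"
        using that \<phi>(2) b by (intro mult_left_mono) auto
      then show ?thesis
        using that nonzero[of \<zeta>] \<rho>1 b1 by (auto simp: \<Phi>1_eq \<Phi>2_eq u_nonneg intro!: mult_right_mono)
    qed
    have near: "b * norm (\<phi> \<zeta> - \<phi> 0) \<le> E \<rho>2 ^ A" if "n \<zeta> \<le> \<rho>2" for \<zeta>
    proof -
      have "norm (\<phi> \<zeta> - \<phi> 0) \<le> n \<zeta> + norm (\<phi> 0 - p)"
        using norm_triangle_ineq4[of "\<phi> \<zeta> - p" "\<phi> 0 - p"] by (simp add: n_def)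
      then have "b * norm (\<phi> \<zeta> - \<phi> 0) \<le> b * (2 * \<rho>2)"
        using that \<phi>(2) b \<rho>1 by (intro mult_left_mono) auto
      then show ?thesis using b2 by simp
    qed
    have glue2: "\<Phi>1 \<zeta> \<le> \<Phi>2 \<zeta>" if "norm \<zeta> < 1" "n \<zeta> = \<rho>2" for \<zeta>
      using that nonzero[of \<zeta>] \<rho>1 near[of \<zeta>]
      by (auto simp: \<Phi>1_eq \<Phi>2_eq u_nonneg intro!: mult_right_mono)

    have u_cont: "continuous_on {\<zeta> \<in> ball 0 1. n \<zeta> \<le> \<rho>} u"
      unfolding u_def
    proof (intro continuous_on_norm continuous_on_compose2[OF cont_f])
      show "continuous_on {\<zeta> \<in> ball 0 1. n \<zeta> \<le> \<rho>} \<phi>"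
        by (rule continuous_on_subset[OF \<phi>_cont]) auto
      show "\<phi> ` {\<zeta> \<in> ball 0 1. n \<zeta> \<le> \<rho>} \<subseteq> closure D \<inter> cball p \<rho>"
        using \<phi>_D closure_subset by (force simp: n_def dist_norm norm_minus_commute)
    qed
    have v_cont: "continuous_on {\<zeta> \<in> ball 0 1. n \<zeta> \<le> \<rho>} v"
      unfolding v_def E_def
      by (intro continuous_intros u_cont continuous_on_subset[OF n_cont]) auto
    have H_cont: "continuous_on (ball 0 1) H"
      unfolding H_def
      by (rule continuous_on_cases_le[OF continuous_on_max[OF v_cont continuous_on_const]
            continuous_on_const n_cont])
        (use v_outer in auto)
    have \<Phi>1_cont: "continuous_on {\<zeta> \<in> ball 0 1. n \<zeta> \<le> \<rho>} \<Phi>1"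
      unfolding \<Phi>1_def
      by (intro continuous_intros u_cont continuous_on_subset[OF G_cont]) auto
    have \<Phi>2_cont: "continuous_on {\<zeta> \<in> ball 0 1. \<rho>1 \<le> n \<zeta>} \<Phi>2"
      unfolding \<Phi>2_def
      by (intro continuous_intros continuous_on_subset[OF H_cont]) (use nonzero in auto)
    have outer_cont: "continuous_on {\<zeta> \<in> ball 0 1. \<rho>1 \<le> n \<zeta>}
       (\<lambda>\<zeta>. if n \<zeta> \<le> \<rho>2 then max (\<Phi>1 \<zeta>) (\<Phi>2 \<zeta>) else \<Phi>2 \<zeta>)"
    proof (rule continuous_on_cases_le)
      show "continuous_on {\<zeta> \<in> {\<zeta> \<in> ball 0 1. \<rho>1 \<le> n \<zeta>}. n \<zeta> \<le> \<rho>2} (\<lambda>\<zeta>. max (\<Phi>1 \<zeta>) (\<Phi>2 \<zeta>))"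
        using \<rho>2 by (intro continuous_on_max continuous_on_subset[OF \<Phi>1_cont] continuous_on_subset[OF \<Phi>2_cont]) auto
      show "continuous_on {\<zeta> \<in> {\<zeta> \<in> ball 0 1. \<rho>1 \<le> n \<zeta>}. \<rho>2 \<le> n \<zeta>} \<Phi>2"
        by (rule continuous_on_subset[OF \<Phi>2_cont]) auto
      show "continuous_on {\<zeta> \<in> ball 0 1. \<rho>1 \<le> n \<zeta>} n"
        by (rule continuous_on_subset[OF n_cont]) auto
    qed (use glue2 in auto)
    have \<Phi>_cont: "continuous_on (ball 0 1) \<Phi>"
      unfolding \<Phi>_def
    proof (rule continuous_on_cases_le[OF _ outer_cont n_cont])
      show "continuous_on {\<zeta> \<in> ball 0 1. n \<zeta> \<le> \<rho>1} \<Phi>1"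
        using \<rho>1 \<rho>2 by (intro continuous_on_subset[OF \<Phi>1_cont]) auto
    qed (use glue1 \<rho>1 in auto)

    have open_less: "open {\<zeta> \<in> ball 0 1. n \<zeta> < a}" for a
      using continuous_open_preimage[OF n_cont open_ball open_lessThan[of a]]
      by (rule back_subst[where P = "open"]) auto
    have open_greater: "open {\<zeta> \<in> ball 0 1. a < n \<zeta>}" for a
      using continuous_open_preimage[OF n_cont open_ball open_greaterThan[of a]]
      by (rule back_subst[where P = "open"]) auto
    have ev_less: "eventually (\<lambda>w. norm w < 1 \<and> n w < a) (nhds \<zeta>)" if "norm \<zeta> < 1" "n \<zeta> < a" for a \<zeta>
      unfolding eventually_nhds
      by (rule exI[of _ "{\<zeta> \<in> ball 0 1. n \<zeta> < a}"]) (use open_less that in auto)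
    have ev_greater: "eventually (\<lambda>w. norm w < 1 \<and> a < n w) (nhds \<zeta>)" if "norm \<zeta> < 1" "a < n \<zeta>" for a \<zeta>
      unfolding eventually_nhds
      by (rule exI[of _ "{\<zeta> \<in> ball 0 1. a < n \<zeta>}"]) (use open_greater that in auto)

    have "(\<lambda>\<zeta>. f (\<phi> \<zeta>)) holomorphic_on {\<zeta> \<in> ball 0 1. n \<zeta> < \<rho>}"
    proof (rule holomorphic_fun_on_compose_curve[OF holo_f _ open_less])
      show "open (D \<inter> ball p \<rho>)" using open_D by auto
      show "(\<lambda>\<zeta>. \<phi> \<zeta> $ i) holomorphic_on {\<zeta> \<in> ball 0 1. n \<zeta> < \<rho>}" for i
        by (rule holomorphic_on_subset[OF \<phi>_holo]) auto
      show "\<phi> ` {\<zeta> \<in> ball 0 1. n \<zeta> < \<rho>} \<subseteq> D \<inter> ball p \<rho>"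
        using \<phi>_D by (auto simp: n_def dist_norm norm_minus_commute)
    qed
    then have u_supp: "holo_support_at u \<zeta>" if "norm \<zeta> < 1" "n \<zeta> < \<rho>" for \<zeta>
      unfolding u_def by (rule holo_support_at_norm[OF _ open_less]) (use that in auto)
    have v_supp: "holo_support_at v \<zeta>" if "norm \<zeta> < 1" "n \<zeta> < \<rho>" for \<zeta>
      unfolding v_def E_def n_def
    proof (intro holo_support_at_mult u_supp that holo_support_at_one_plus_norm_square[where S = "ball 0 1"])
      show "(\<lambda>w. (\<phi> w - p) $ i) holomorphic_on ball 0 1" for i
        unfolding vector_minus_component by (intro holomorphic_intros \<phi>_holo)
    qed (use that \<epsilon> in auto)
    \<comment> \<open>Where \<open>H\<close> equals \<open>c\<close>, its minimum, the constant
      supports it. Elsewhere \<open>H = v > c\<close>, which by \<open>v_outer\<close> forces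
      \<open>n \<zeta> < \<rho>\<close>, so \<open>v \<le> H\<close> in a whole
      neighborhood.\<close>
    have H_supp: "holo_support_at H \<zeta>" if "norm \<zeta> < 1" for \<zeta>
    proof (cases "H \<zeta> = c")
      case True
      show ?thesis
        by (rule holo_support_at_mono[OF holo_support_at_const[of c]]) (use True c H_lower in auto)
    next
      case False
      then have *: "n \<zeta> \<le> \<rho>" "H \<zeta> = v \<zeta>" "c < v \<zeta>" by (auto simp: H_def max_def split: if_splits)
      then have "n \<zeta> < \<rho>" using v_outer[OF that] by fastforce
      show ?thesis
      proof (rule holo_support_at_mono[where \<Phi> = H, OF v_supp[OF that \<open>n \<zeta> < \<rho>\<close>] *(2)])
        show "eventually (\<lambda>w. v w \<le> H w) (nhds \<zeta>)"
          using ev_less[OF that \<open>n \<zeta> < \<rho>\<close>] by eventually_elim (auto simp: H_def)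
      qed
    qed
    have \<Phi>1_supp: "holo_support_at \<Phi>1 \<zeta>" if "norm \<zeta> < 1" "n \<zeta> < \<rho>" for \<zeta>
      unfolding \<Phi>1_def
      by (intro holo_support_at_mult holo_support_at_const holo_support_at_power u_supp that
          holo_support_at_norm_vec[where S = "ball 0 1"])
        (use b h that in \<open>auto simp: G_def\<close>)
    have \<Phi>2_supp: "holo_support_at \<Phi>2 \<zeta>" if "norm \<zeta> < 1" "\<zeta> \<noteq> 0" for \<zeta>
      unfolding \<Phi>2_def
      by (intro holo_support_at_mult holo_support_at_power H_supp that
          holo_support_at_norm[where S = "- {0}"])
        (use that in \<open>auto intro!: holomorphic_intros\<close>)
    \<comment> \<open>\<open>\<Phi>1\<close> minorizes \<open>\<Phi>\<close> on the open set
      \<open>n < \<rho>2\<close>, and \<open>\<Phi>2\<close> does so on \<open>n > \<rho>1\<close>.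
      By \<open>glue2\<close> the value at \<open>n \<zeta> = \<rho>2\<close> is that of
      \<open>\<Phi>2\<close>, so some branch is always attained inside its own region.\<close>
    have \<Phi>_supp: "holo_support_at \<Phi> \<zeta>" if "norm \<zeta> < 1" for \<zeta>
    proof (cases "n \<zeta> < \<rho>2 \<and> \<Phi> \<zeta> = \<Phi>1 \<zeta>")
      case True
      show ?thesis
      proof (rule holo_support_at_mono[OF \<Phi>1_supp])
        show "eventually (\<lambda>w. \<Phi>1 w \<le> \<Phi> w) (nhds \<zeta>)"
          using ev_less[of \<zeta> \<rho>2] True that by (auto simp: \<Phi>_def elim: eventually_mono)
      qed (use True that \<rho>2 in auto)
    next
      case False
      then have *: "\<rho>1 < n \<zeta>" "\<Phi> \<zeta> = \<Phi>2 \<zeta>"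
        using glue2[OF that] \<rho>1 by (auto simp: \<Phi>_def max_def split: if_splits)
      show ?thesis
      proof (rule holo_support_at_mono[OF \<Phi>2_supp])
        show "eventually (\<lambda>w. \<Phi>2 w \<le> \<Phi> w) (nhds \<zeta>)"
          using ev_greater[of \<zeta> \<rho>1] * that by (auto simp: \<Phi>_def elim: eventually_mono)
      qed (use * that nonzero[of \<zeta>] in auto)
    qed

    have bound: "\<Phi> \<zeta> \<le> 2 * K" if "norm \<zeta> = 1 / 2" for \<zeta>
    proof -
      have \<zeta>: "norm \<zeta> < 1" "\<zeta> \<noteq> 0" using that by auto
      have \<zeta>2: "norm (1 / \<zeta>) = 2" unfolding norm_divide that by simp
      have "\<Phi>1 \<zeta> \<le> K * 1 * 2" if "n \<zeta> \<le> \<rho>2"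
      proof -
        have "E \<rho>2 ^ A \<le> K"
          unfolding K_def using \<rho>2 E(2)[of \<rho>2] by (intro power_mono E_mono) auto
        moreover have "u \<zeta> ^ A \<le> 1"
          using u_less[OF \<zeta>(1)] that \<rho>2 by (intro power_le_one u_nonneg) auto
        ultimately show ?thesis
          unfolding \<Phi>1_eq[OF \<zeta>(1,2)] \<zeta>2 using near[OF that] K u_nonneg
          by (intro mult_right_mono mult_mono) auto
      qed
      moreover have "\<Phi>2 \<zeta> \<le> K * 2"
        unfolding \<Phi>2_def \<zeta>2 K_def using H_upper[OF \<zeta>(1)] H_lower[of \<zeta>] c
        by (intro mult_right_mono power_mono) auto
      ultimately show ?thesis using \<rho>1 by (auto simp: \<Phi>_def)
    qed
    show ?thesis
    proof (rule ccontr)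
      assume "\<not> norm (\<phi> \<zeta>0 - p) < \<rho>"
      then have n0: "\<rho>2 < n \<zeta>0" using \<rho>2 by (simp add: n_def)
      have "\<Phi> \<zeta>0 \<le> 2 * K"
      proof (rule holo_support_max_principle[where t = "1/2", OF _ _ _ bound])
        show "continuous_on (cball 0 (1 / 2)) \<Phi>"
          by (rule continuous_on_subset[OF \<Phi>_cont]) auto
      qed (use \<Phi>_supp \<zeta>0 r0 in auto)
      moreover have "\<Phi> \<zeta>0 = \<Phi>2 \<zeta>0" using n0 \<rho>1 by (simp add: \<Phi>_def)
      moreover have "\<Phi>2 \<zeta>0 \<ge> c ^ A * norm (1 / \<zeta>0)"
        unfolding \<Phi>2_def using H_lower c by (intro mult_right_mono power_mono) auto
      moreover have "\<zeta>0 \<noteq> 0" using nonzero[of \<zeta>0] n0 \<rho>1 by auto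
      ultimately have "c ^ A * norm (1 / \<zeta>0) * norm \<zeta>0 \<le> 2 * K * norm \<zeta>0"
        by (intro mult_right_mono) auto
      then have "c ^ A \<le> 2 * K * norm \<zeta>0" using \<open>\<zeta>0 \<noteq> 0\<close> by (simp add: norm_divide)
      then show False using \<zeta>0 K by (simp add: r0_def field_simps)
    qed
  qed
  show thesis
    by (rule that[of \<rho>1 r0]) (use \<rho>1 \<rho>2 r0 main in auto)
qed

end

section \<open>Estimates for \<open>artanh\<close> and a Schwarz-Pick inequality\<close>

lemma artanh_real_ge:
  fixes t :: real
  assumes "0 \<le> t" "t < 1"
  shows "t \<le> artanh t"
proof -
  have "artanh 0 - 0 \<le> artanh t - t"
  proof (rule DERIV_nonneg_imp_nondecreasing[OF assms(1)])
    fix x :: real assume x: "0 \<le> x" "x \<le> t"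
    then have "x\<^sup>2 < 1" using assms by (simp add: abs_square_less_1)
    then show "\<exists>y. ((\<lambda>x. artanh x - x) has_real_derivative y) (at x) \<and> 0 \<le> y"
      using x assms
      by (intro exI[of _ "1 / (1 - x\<^sup>2) - 1"]) (auto intro!: derivative_eq_intros simp: field_simps)
  qed
  then show ?thesis by simp
qed

lemma artanh_real_mono:
  fixes s t :: real
  assumes "0 \<le> s" "s \<le> t" "t < 1"
  shows "artanh s \<le> artanh t"
proof -
  have "(1 + s) / (1 - s) \<le> (1 + t) / (1 - t)"
    using assms by (intro frac_le) auto
  then show ?thesis using assms by (simp add: artanh_def)
qed

lemma artanh_real_le_twice:
  fixes t :: real
  assumes "0 \<le> t" "t \<le> 1 / 2"
  shows "artanh t \<le> 2 * t"
proof -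
  have "ln ((1 + t) / (1 - t)) \<le> (1 + t) / (1 - t) - 1"
    using assms by (intro ln_le_minus_one) auto
  also have "\<dots> = 2 * t / (1 - t)" using assms by (simp add: field_simps)
  also have "\<dots> \<le> 2 * t / (1 / 2)" using assms by (intro divide_left_mono) auto
  finally show ?thesis by (simp add: artanh_def)
qed

text \<open>Move \<open>a = g 0\<close> to 0 by a Moebius map and apply the Schwarz lemma to get
  \<open>s\<close> with \<open>norm s \<le> norm \<mu>\<close>. Solving for \<open>g \<mu>\<close>
  gives \<open>(1 - g \<mu>) * (1 + cnj a * s) = (1 - a) - s * (1 - cnj a)\<close>, and
  \<open>1 - cnj a\<close> has the same modulus as \<open>1 - a\<close>.\<close>

lemma Schwarz_Pick_one_minus:
  assumes g: "g holomorphic_on ball 0 1" "\<And>w. norm w < 1 \<Longrightarrow> norm (g w) < 1" and \<mu>: "norm \<mu> < 1"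
  shows "norm (1 - g \<mu>) * (1 - norm \<mu>) \<le> norm (1 - g 0) * (1 + norm \<mu>)"
    and "norm (1 - g 0) * (1 - norm \<mu>) \<le> norm (1 - g \<mu>) * (1 + norm \<mu>)"
proof -
  define a where "a = g 0"
  have a: "norm a < 1" using g(2)[of 0] by (simp add: a_def)
  define \<psi> where "\<psi> = (\<lambda>w. Moebius_function 0 a (g w))"
  have "\<psi> holomorphic_on ball 0 1"
    unfolding \<psi>_def
    using holomorphic_on_compose_gen[OF g(1) Moebius_function_holomorphic[OF a, of 0]] g(2)
    by (simp add: o_def image_subset_iff)
  moreover have "norm (\<psi> w) < 1" if "norm w < 1" for w
    unfolding \<psi>_def by (rule Moebius_function_norm_lt_1[OF a g(2)[OF that]])
  ultimately have s: "norm (\<psi> \<mu>) \<le> norm \<mu>"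
    using \<mu> by (intro Schwarz_Lemma) (auto simp: \<psi>_def a_def Moebius_function_simple)
  define s where "s = \<psi> \<mu>"
  have ne: "1 - cnj a * g \<mu> \<noteq> 0"
  proof
    assume "1 - cnj a * g \<mu> = 0"
    then have "norm a * norm (g \<mu>) = 1" by (metis complex_mod_cnj eq_iff_diff_eq_0 norm_mult norm_one)
    moreover have "norm a * norm (g \<mu>) \<le> norm a * 1" using g(2)[OF \<mu>] by (intro mult_left_mono) auto
    ultimately show False using a by simp
  qed
  then have "s * (1 - cnj a * g \<mu>) = g \<mu> - a"
    by (simp add: s_def \<psi>_def Moebius_function_simple)
  then have "(1 - g \<mu>) * (1 + cnj a * s) = (1 - a) - s * (1 - cnj a)"
    by (simp add: algebra_simps)
  then have eq: "norm (1 - g \<mu>) * norm (1 + cnj a * s) = norm ((1 - a) - s * (1 - cnj a))"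
    by (metis norm_mult)
  have cs: "norm (cnj a * s) \<le> norm \<mu>"
  proof -
    have "norm a * norm s \<le> 1 * norm \<mu>" using a s by (intro mult_mono) (auto simp: s_def)
    then show ?thesis by (simp add: norm_mult)
  qed
  have "norm (1 - cnj a) = norm (1 - a)" by (metis complex_cnj_diff complex_cnj_one complex_mod_cnj)
  then have sa: "norm (s * (1 - cnj a)) \<le> norm \<mu> * norm (1 - a)"
    using s by (auto simp: norm_mult s_def intro!: mult_right_mono)
  have "norm (1 - g \<mu>) * (1 - norm \<mu>) \<le> norm (1 - g \<mu>) * norm (1 + cnj a * s)"
    using norm_diff_ineq[of 1 "cnj a * s"] cs by (intro mult_left_mono) auto
  also have "\<dots> \<le> norm (1 - a) * (1 + norm \<mu>)"
    unfolding eq using norm_triangle_ineq4[of "1 - a" "s * (1 - cnj a)"] sa by (simp add: algebra_simps)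
  finally show "norm (1 - g \<mu>) * (1 - norm \<mu>) \<le> norm (1 - g 0) * (1 + norm \<mu>)" by (simp add: a_def)
  have "norm (1 - a) * (1 - norm \<mu>) \<le> norm (1 - g \<mu>) * norm (1 + cnj a * s)"
    unfolding eq using norm_triangle_ineq2[of "1 - a" "s * (1 - cnj a)"] sa by (simp add: algebra_simps)
  also have "\<dots> \<le> norm (1 - g \<mu>) * (1 + norm \<mu>)"
    using norm_triangle_ineq[of 1 "cnj a * s"] cs by (intro mult_left_mono) auto
  finally show "norm (1 - g 0) * (1 - norm \<mu>) \<le> norm (1 - g \<mu>) * (1 + norm \<mu>)" by (simp add: a_def)
qed

section \<open>Comparison principles for the Kobayashi pseudodistance\<close>

lemma kobayashi_disc_le:
  assumes "holomorphic_disc D \<phi>" "norm \<mu> < 1"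
  shows "kobayashi D (\<phi> 0) (\<phi> \<mu>) \<le> ennreal (artanh (norm \<mu>))"
proof -
  have "\<phi> 0 \<in> D" "\<phi> \<mu> \<in> D" using assms by (auto simp: holomorphic_disc_def)
  then have "kobayashi D (\<phi> 0) (\<phi> \<mu>) \<le> lempert D (\<phi> 0) (\<phi> \<mu>)"
    using kobayashi_largest(2)[of D] by (simp add: below_lempert_def)
  also have "\<dots> \<le> ennreal (artanh (norm \<mu>))"
    unfolding lempert_def by (rule Inf_lower) (use assms in auto)
  finally show ?thesis .
qed

lemma below_lempertI:
  assumes "\<And>\<phi> \<mu>. holomorphic_disc D \<phi> \<Longrightarrow> norm \<mu> < 1 \<Longrightarrow> d (\<phi> 0) (\<phi> \<mu>) \<le> ennreal (artanh (norm \<mu>))"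
  shows "below_lempert D d"
  unfolding below_lempert_def lempert_def using assms by (auto intro!: Inf_greatest)

text \<open>Discs in \<open>D'\<close> are discs in \<open>D\<close>, so \<open>kobayashi D\<close>
  competes in the supremum defining \<open>kobayashi D'\<close>.\<close>

lemma kobayashi_mono_domain:
  assumes "D' \<subseteq> D"
  shows "kobayashi D z w \<le> kobayashi D' z w"
proof (rule kobayashi_largest(3))
  show "pseudodistance_on D' (kobayashi D)"
    using kobayashi_largest(1)[of D] assms unfolding pseudodistance_on_def by blast
  show "below_lempert D' (kobayashi D)"
  proof (rule below_lempertI)
    fix \<phi> :: "complex \<Rightarrow> complex ^ 'a" and \<mu> :: complex
    assume "holomorphic_disc D' \<phi>" "norm \<mu> < 1"
    then show "kobayashi D (\<phi> 0) (\<phi> \<mu>) \<le> ennreal (artanh (norm \<mu>))"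
      using assms by (intro kobayashi_disc_le) (auto simp: holomorphic_disc_def)
  qed
qed

text \<open>A real function that is contracting along discs induces a competitor for
  \<open>kobayashi D\<close>. It is applied to the logarithm of \<open>norm (1 - f x)\<close> and to
  a truncated distance.\<close>

lemma kobayashi_ge_abs_diff:
  fixes F :: "complex ^ 'n \<Rightarrow> real"
  assumes "\<And>\<phi> \<mu>. holomorphic_disc D \<phi> \<Longrightarrow> norm \<mu> < 1 \<Longrightarrow> \<bar>F (\<phi> 0) - F (\<phi> \<mu>)\<bar> \<le> artanh (norm \<mu>)"
  shows "ennreal \<bar>F z - F w\<bar> \<le> kobayashi D z w"
proof (rule kobayashi_largest(3))
  show "pseudodistance_on D (\<lambda>z w. ennreal \<bar>F z - F w\<bar>)"
    unfolding pseudodistance_on_def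
    by (auto simp: abs_minus_commute ennreal_plus[symmetric] simp del: ennreal_plus intro!: ennreal_leI)
  show "below_lempert D (\<lambda>z w. ennreal \<bar>F z - F w\<bar>)"
    by (intro below_lempertI ennreal_leI assms)
qed

section \<open>Kobayashi distance near the peak point\<close>

context peak_function
begin

text \<open>Taking logarithms in the Schwarz-Pick inequality for \<open>f\<close> along a disc
  bounds the change of \<open>ln (norm (1 - f x))\<close> by \<open>ln (1 + t) - ln (1 - t)\<close>,
  twice \<open>artanh t\<close>.\<close>

lemma kobayashi_ge_log:
  "ennreal \<bar>ln (norm (1 - f z)) / 2 - ln (norm (1 - f w)) / 2\<bar> \<le> kobayashi (D \<inter> ball p \<rho>) z w"
proof (rule kobayashi_ge_abs_diff)
  fix \<phi> :: "complex \<Rightarrow> complex ^ 'n" and \<mu> :: complex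
  assume \<phi>: "holomorphic_disc (D \<inter> ball p \<rho>) \<phi>" and \<mu>: "norm \<mu> < 1"
  define g where "g = (\<lambda>\<zeta>. f (\<phi> \<zeta>))"
  have g1: "g holomorphic_on ball 0 1"
    unfolding g_def
    by (rule holomorphic_fun_on_compose_curve[OF holo_f])
      (use \<phi> open_D in \<open>auto simp: holomorphic_disc_def\<close>)
  have g2: "norm (g \<zeta>) < 1" if "norm \<zeta> < 1" for \<zeta>
  proof -
    have "\<phi> \<zeta> \<in> D" "dist p (\<phi> \<zeta>) < \<rho>"
      using \<phi> that by (auto simp: holomorphic_disc_def image_subset_iff)
    then show ?thesis
      unfolding g_def using closure_subset p_notin
      by (intro f_less) (auto simp: dist_norm norm_minus_commute)
  qed
  define t where "t = norm \<mu>"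
  have t: "0 \<le> t" "t < 1" using \<mu> by (auto simp: t_def)
  have pos: "norm (1 - g 0) > 0" "norm (1 - g \<mu>) > 0" using g2[of 0] g2[OF \<mu>] by auto
  note S = Schwarz_Pick_one_minus[OF g1 g2 \<mu>, folded t_def]
  have "ln (norm (1 - g \<mu>)) + ln (1 - t) \<le> ln (norm (1 - g 0)) + ln (1 + t)"
    "ln (norm (1 - g 0)) + ln (1 - t) \<le> ln (norm (1 - g \<mu>)) + ln (1 + t)"
    using S pos t by (simp_all add: ln_mult_pos[symmetric])
  moreover have "artanh t = (ln (1 + t) - ln (1 - t)) / 2"
    using t by (simp add: artanh_def ln_div)
  moreover have "\<bar>x / 2 - y / 2\<bar> \<le> c" if "y + b \<le> x + a" "x + b \<le> y + a" "c = (a - b) / 2"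
    for a b c x y :: real
    using that by (simp add: abs_le_iff field_simps)
  ultimately show "\<bar>ln (norm (1 - f (\<phi> 0))) / 2 - ln (norm (1 - f (\<phi> \<mu>))) / 2\<bar> \<le> artanh (norm \<mu>)"
    unfolding g_def t_def by blast
qed

text \<open>Compactness: away from \<open>p\<close> the function \<open>1 - f\<close> has no zero.
  Together with \<open>f_tendsto_one\<close> this makes \<open>norm (1 - f x)\<close> a gauge of
  closeness to \<open>p\<close>.\<close>

lemma separation_from_one:
  assumes "s > 0"
  obtains \<kappa> where "\<kappa> > 0"
    "\<And>x. x \<in> closure D \<Longrightarrow> norm (x - p) \<le> \<rho> \<Longrightarrow> norm (1 - f x) < \<kappa> \<Longrightarrow> norm (x - p) < s"
proof -
  define K where "K = (closure D \<inter> cball p \<rho>) \<inter> (- ball p s)"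
  have "\<exists>\<kappa>>0. \<forall>x\<in>K. \<kappa> \<le> norm (1 - f x)"
  proof (cases "K = {}")
    case True
    then show ?thesis by (intro exI[of _ 1]) auto
  next
    case False
    have "compact (closure D \<inter> cball p \<rho>)"
      by (rule closed_Int_compact[OF closed_closure compact_cball])
    from compact_Int_closed[OF this closed_Compl[OF open_ball]]
    have "compact K" unfolding K_def .
    moreover have "continuous_on K (\<lambda>x. norm (1 - f x))"
      by (intro continuous_intros continuous_on_subset[OF cont_f]) (auto simp: K_def)
    ultimately obtain x where x: "x \<in> K" "\<And>y. y \<in> K \<Longrightarrow> norm (1 - f x) \<le> norm (1 - f y)"
      using continuous_attains_inf False by metis
    from x(1) have "norm (f x) < 1"
      using assms by (intro f_less) (auto simp: K_def dist_norm norm_minus_commute)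
    then have "norm (1 - f x) > 0" by auto
    then show ?thesis using x(2) by blast
  qed
  then obtain \<kappa> where "\<kappa> > 0" "\<forall>x\<in>K. \<kappa> \<le> norm (1 - f x)" by blast
  then show thesis
    by (intro that[of \<kappa>]) (force simp: K_def dist_norm norm_minus_commute)+
qed

lemma f_tendsto_one:
  assumes "\<kappa> > 0"
  obtains \<delta> where "0 < \<delta>" "\<delta> \<le> \<rho>"
    "\<And>x. x \<in> closure D \<Longrightarrow> norm (x - p) < \<delta> \<Longrightarrow> norm (1 - f x) < \<kappa>"
proof -
  obtain d where d: "d > 0"
    "\<And>x. x \<in> closure D \<inter> cball p \<rho> \<Longrightarrow> dist x p < d \<Longrightarrow> dist (f x) (f p) < \<kappa>"
    using cont_f assms p_closure \<rho>_pos unfolding continuous_on_iff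
    by (metis IntI centre_in_cball less_eq_real_def)
  show thesis
    by (rule that[of "min d \<rho>"])
      (use d \<rho>_pos f_p in \<open>auto simp: dist_norm norm_minus_commute\<close>)
qed

end

section \<open>Localization of Kobayashi balls\<close>

context peak_function
begin

text \<open>Since \<^const>\<open>kobayashi\<close> is the largest pseudodistance below \<^const>\<open>lempert\<close>, chains of discs
  can be avoided: \<open>F\<close> below is the distance from \<open>z\<close> in \<open>D \<inter> ball p \<rho>\<close>, rescaled, truncated at
  \<open>R\<close> and extended by \<open>R\<close>. Where \<open>F < R\<close> the point is close to \<open>p\<close> and discs localize, so \<open>F\<close> is
  1-Lipschitz along all discs in \<open>D\<close> and \<open>norm (F x - F y)\<close> is a competitor for \<open>kobayashi D\<close>.\<close>

lemma kobayashi_ball_localization: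
  assumes R: "R > 0"
  obtains C \<delta> where "C > 0" "\<delta> > 0"
    "\<And>z. z \<in> D \<Longrightarrow> norm (z - p) < \<delta> \<Longrightarrow> kobayashi_ball D z R \<subseteq> kobayashi_ball (D \<inter> ball p \<rho>) z C"
proof -
  obtain \<rho>1 r0 where \<rho>1: "0 < \<rho>1" "\<rho>1 < \<rho>" and r0: "0 < r0" "r0 < 1"
    and disc: "\<And>\<phi> \<zeta>. holomorphic_disc D \<phi> \<Longrightarrow> norm (\<phi> 0 - p) < \<rho>1 / 2 \<Longrightarrow> norm \<zeta> < r0 \<Longrightarrow>
       norm (\<phi> \<zeta> - p) < \<rho>"
    by (rule disc_localization) blast
  \<comment> \<open>Beyond radius \<open>\<sigma>\<close> one has
    \<open>artanh (norm \<mu>) \<ge> R\<close>, which bounds any variation of a function with values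
    between 0 and \<open>R\<close>; only parameters up to \<open>\<sigma>\<close> need work.\<close>
  define \<sigma> where "\<sigma> = tanh R"
  have \<sigma>: "0 < \<sigma>" "\<sigma> < 1" using R by (auto simp: \<sigma>_def tanh_real_lt_1)
  \<comment> \<open>The Lipschitz loss: \<open>1 - \<sigma>\<close> from recentring a disc at a
    parameter of modulus at most \<open>\<sigma>\<close>, \<open>r0\<close> from shrinking it into
    the ball, and 2 from \<open>artanh t \<le> 2 * t\<close>.\<close>
  define C where "C = 2 / ((1 - \<sigma>) * r0)"
  have C: "C > 0" using \<sigma> r0 by (simp add: C_def)
  obtain \<kappa> where \<kappa>: "\<kappa> > 0"
    "\<And>x. x \<in> closure D \<Longrightarrow> norm (x - p) \<le> \<rho> \<Longrightarrow> norm (1 - f x) < \<kappa> \<Longrightarrow> norm (x - p) < \<rho>1 / 2"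
    using separation_from_one[of "\<rho>1 / 2"] \<rho>1 by auto
  \<comment> \<open>By \<open>kobayashi_ge_log\<close>, moving a distance below \<open>C * R\<close>
    multiplies \<open>norm (1 - f x)\<close> by less than \<open>exp (2 * (C * R))\<close>, so
    starting within \<open>\<delta>\<close> keeps it below \<open>\<kappa>\<close>.\<close>
  obtain \<delta> where \<delta>: "0 < \<delta>" "\<delta> \<le> \<rho>"
    "\<And>x. x \<in> closure D \<Longrightarrow> norm (x - p) < \<delta> \<Longrightarrow> norm (1 - f x) < \<kappa> / exp (2 * (C * R))"
    using f_tendsto_one[of "\<kappa> / exp (2 * (C * R))"] \<kappa>(1) by auto
  define D' where "D' = D \<inter> ball p \<rho>"
  have "kobayashi_ball D z R \<subseteq> kobayashi_ball D' z (C * R)"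
    if z: "z \<in> D" "norm (z - p) < \<delta>" for z
  proof -
    have zD': "z \<in> D'" using z \<delta> by (auto simp: D'_def dist_norm norm_minus_commute)
    define k where "k = kobayashi D' z"
    have pos: "norm (1 - f x) > 0" if "x \<in> D'" for x
    proof -
      have "norm (f x) < 1"
        using that closure_subset p_notin
        by (intro f_less) (auto simp: D'_def dist_norm norm_minus_commute)
      then show ?thesis by auto
    qed
    have near: "norm (x - p) < \<rho>1 / 2" if x: "x \<in> D'" "k x < ennreal (C * R)" for x
    proof -
      have "ennreal \<bar>ln (norm (1 - f z)) / 2 - ln (norm (1 - f x)) / 2\<bar> < ennreal (C * R)"
        using kobayashi_ge_log[of z x] x(2) unfolding k_def D'_def by (rule order_le_less_trans)
      then have "\<bar>ln (norm (1 - f z)) / 2 - ln (norm (1 - f x)) / 2\<bar> < C * R"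
        by (simp add: ennreal_less_iff)
      then have "ln (norm (1 - f x)) < ln (norm (1 - f z)) + 2 * (C * R)" by linarith
      then have "exp (ln (norm (1 - f x))) < exp (ln (norm (1 - f z)) + 2 * (C * R))" by simp
      then have "norm (1 - f x) < norm (1 - f z) * exp (2 * (C * R))"
        using pos[OF x(1)] pos[OF zD'] by (simp add: exp_add del: exp_less_cancel_iff)
      also have "\<dots> < \<kappa>"
        using \<delta>(3)[of z] z closure_subset[of D] by (auto simp: pos_less_divide_eq)
      finally show ?thesis
        using x(1) closure_subset[of D]
        by (intro \<kappa>(2)) (auto simp: D'_def dist_norm norm_minus_commute)
    qed
    \<comment> \<open>The minimum is taken before \<open>enn2real\<close>, which would send an
      infinite distance to 0.\<close>
    define F where "F = (\<lambda>x. if x \<in> D' then enn2real (min (k x) (ennreal (C * R))) / C else R)"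
    have F_le: "F x \<le> R" for x
    proof -
      have "enn2real (min (k x) (ennreal (C * R))) \<le> C * R"
        using C R by (intro enn2real_leI) auto
      then show ?thesis using C by (simp add: F_def field_simps)
    qed
    have F_nonneg: "0 \<le> F x" for x using C R by (simp add: F_def)
    have F_less: "x \<in> D' \<and> k x < ennreal (C * R)" if "F x < R" for x
    proof -
      have "x \<in> D'" using that by (auto simp: F_def split: if_splits)
      moreover have "k x < ennreal (C * R)"
      proof (rule ccontr)
        assume "\<not> k x < ennreal (C * R)"
        then have "F x = R" using \<open>x \<in> D'\<close> C R by (simp add: F_def min_def not_less)
        then show False using that by simp
      qed
      ultimately show ?thesis by simp
    qed
    \<comment> \<open>If \<open>F (\<psi> 0) = R\<close> there is nothing to show, as
      \<open>R\<close> is the maximum. Otherwise \<open>\<psi> 0\<close> is near \<open>p\<close>,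
      so the disc of radius \<open>r0\<close> stays in \<open>D'\<close> and the triangle inequality
      for \<open>kobayashi D'\<close> applies.\<close>
    have F_step: "F (\<psi> w) \<le> F (\<psi> 0) + 2 * norm w / (C * r0)"
      if \<psi>: "holomorphic_disc D \<psi>" and w: "norm w < r0 / 2" for \<psi> w
    proof (cases "F (\<psi> 0) < R")
      case False
      moreover have "0 \<le> 2 * norm w / (C * r0)" using C r0 by simp
      ultimately show ?thesis using F_le[of "\<psi> w"] by linarith
    next
      case True
      from F_less[OF True] have x: "\<psi> 0 \<in> D'" "k (\<psi> 0) < ennreal (C * R)" by auto
      have loc: "\<psi> \<zeta> \<in> D'" if "norm \<zeta> < r0" for \<zeta>
        using disc[OF \<psi> near[OF x] that] \<psi> that r0
        by (auto simp: D'_def holomorphic_disc_def image_subset_iff dist_norm norm_minus_commute)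
      have scale: "r0 * norm \<zeta> < 1" if "norm \<zeta> < 1" for \<zeta> :: complex
        using mult_left_le_one_le[of "norm \<zeta>" r0] r0 that by simp
      define \<theta> where "\<theta> = (\<lambda>\<zeta>. \<psi> (of_real r0 * \<zeta>))"
      have "holomorphic_disc D' \<theta>"
        unfolding holomorphic_disc_def
      proof (intro conjI allI)
        fix i
        have "(\<lambda>\<zeta>. \<psi> \<zeta> $ i) \<circ> (\<lambda>\<zeta> :: complex. of_real r0 * \<zeta>) holomorphic_on ball 0 1"
        proof (rule holomorphic_on_compose_gen)
          show "(\<lambda>\<zeta>. \<psi> \<zeta> $ i) holomorphic_on ball 0 1"
            using \<psi> by (simp add: holomorphic_disc_def)
          show "(\<lambda>\<zeta> :: complex. of_real r0 * \<zeta>) ` ball 0 1 \<subseteq> ball 0 1"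
            using scale r0 by (auto simp: norm_mult)
        qed (intro holomorphic_intros)
        then show "(\<lambda>\<zeta>. \<theta> \<zeta> $ i) holomorphic_on ball 0 1" by (simp add: \<theta>_def o_def)
      next
        show "\<theta> ` ball 0 1 \<subseteq> D'"
          using r0 by (auto simp: \<theta>_def norm_mult intro!: loc)
      qed
      moreover define \<mu> where "\<mu> = w / of_real r0"
      have \<mu>: "norm \<mu> = norm w / r0" "norm \<mu> \<le> 1 / 2" "norm \<mu> < 1"
        using w r0 by (auto simp: \<mu>_def norm_divide field_simps)
      ultimately have "kobayashi D' (\<theta> 0) (\<theta> \<mu>) \<le> ennreal (artanh (norm \<mu>))"
        by (intro kobayashi_disc_le)
      also have "\<dots> \<le> ennreal (2 * norm \<mu>)"
        using \<mu>(2) by (intro ennreal_leI artanh_real_le_twice) auto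
      finally have "kobayashi D' (\<psi> 0) (\<psi> w) \<le> ennreal (2 * norm \<mu>)"
        using r0 by (simp add: \<theta>_def \<mu>_def)
      moreover have wD': "\<psi> w \<in> D'" using w r0 by (intro loc) auto
      then have "k (\<psi> w) \<le> k (\<psi> 0) + kobayashi D' (\<psi> 0) (\<psi> w)"
        using kobayashi_largest(1)[of D'] zD' x(1) unfolding k_def pseudodistance_on_def by blast
      ultimately have le: "k (\<psi> w) \<le> k (\<psi> 0) + ennreal (2 * norm \<mu>)"
        by (meson add_left_mono order_trans)
      have k0: "k (\<psi> 0) = ennreal (C * F (\<psi> 0))"
        using x C by (simp add: F_def min_def less_imp_le ennreal_enn2real_if top_unique) (use less_top_ennreal in auto)
      have "enn2real (min (k (\<psi> w)) (ennreal (C * R))) \<le> C * F (\<psi> 0) + 2 * norm \<mu>"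
        using le C F_nonneg[of "\<psi> 0"] unfolding k0
        by (intro enn2real_leI) (auto simp: ennreal_plus[symmetric] min_le_iff_disj simp del: ennreal_plus)
      then have "F (\<psi> w) \<le> (C * F (\<psi> 0) + 2 * norm \<mu>) / C"
        using wD' C by (simp add: F_def divide_right_mono)
      also have "\<dots> = F (\<psi> 0) + 2 * norm w / (C * r0)"
        using C r0 by (simp add: \<mu>(1) field_simps)
      finally show ?thesis .
    qed
    \<comment> \<open>The disc is recentred at \<open>\<zeta>\<close> and rescaled by
      \<open>1 - \<sigma>\<close>; the choice of \<open>C\<close> makes the resulting constant
      exactly 1.\<close>
    have F_local: "F (\<phi> \<zeta>') \<le> F (\<phi> \<zeta>) + norm (\<zeta>' - \<zeta>)"
      if \<phi>: "holomorphic_disc D \<phi>" and \<zeta>: "norm \<zeta> \<le> \<sigma>"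
        and close: "norm (\<zeta>' - \<zeta>) < (1 - \<sigma>) * r0 / 2" for \<phi> \<zeta> \<zeta>'
    proof -
      define \<psi> where "\<psi> = (\<lambda>w. \<phi> (\<zeta> + of_real (1 - \<sigma>) * w))"
      have inside: "norm (\<zeta> + of_real (1 - \<sigma>) * w) < 1" if "norm w < 1" for w
      proof -
        have "norm (\<zeta> + of_real (1 - \<sigma>) * w) \<le> norm \<zeta> + norm (of_real (1 - \<sigma>) * w)"
          by (rule norm_triangle_ineq)
        also have "norm (of_real (1 - \<sigma>) * w) = (1 - \<sigma>) * norm w"
          using \<sigma> by (simp add: norm_mult del: of_real_diff)
        also have "\<dots> < 1 - \<sigma>" using \<sigma> that by simp
        finally show ?thesis using \<zeta> by simp
      qed
      have "holomorphic_disc D \<psi>"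
        unfolding holomorphic_disc_def
      proof (intro conjI allI)
        fix i
        have "(\<lambda>\<zeta>. \<phi> \<zeta> $ i) \<circ> (\<lambda>w. \<zeta> + of_real (1 - \<sigma>) * w) holomorphic_on ball 0 1"
        proof (rule holomorphic_on_compose_gen)
          show "(\<lambda>\<zeta>. \<phi> \<zeta> $ i) holomorphic_on ball 0 1"
            using \<phi> by (simp add: holomorphic_disc_def)
          show "(\<lambda>w. \<zeta> + of_real (1 - \<sigma>) * w) ` ball 0 1 \<subseteq> ball 0 1"
            using inside by (auto simp del: of_real_diff)
        qed (intro holomorphic_intros)
        then show "(\<lambda>w. \<psi> w $ i) holomorphic_on ball 0 1" by (simp add: \<psi>_def o_def)
      next
        show "\<psi> ` ball 0 1 \<subseteq> D"
          using inside \<phi> by (auto simp: \<psi>_def holomorphic_disc_def image_subset_iff simp del: of_real_diff)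
      qed
      moreover define w where "w = (\<zeta>' - \<zeta>) / of_real (1 - \<sigma>)"
      have w: "norm w = norm (\<zeta>' - \<zeta>) / (1 - \<sigma>)"
        using \<sigma> by (simp add: w_def norm_divide del: of_real_diff)
      moreover have "norm w < r0 / 2" using close \<sigma> unfolding w by (simp add: field_simps)
      ultimately have "F (\<psi> w) \<le> F (\<psi> 0) + 2 * norm w / (C * r0)" by (intro F_step)
      moreover have "2 * norm w / (C * r0) = norm (\<zeta>' - \<zeta>)"
        unfolding w using \<sigma> r0 by (simp add: C_def)
      moreover have "of_real (1 - \<sigma>) * w = \<zeta>' - \<zeta>" using \<sigma> by (simp add: w_def del: of_real_diff)
      ultimately show ?thesis by (simp add: \<psi>_def del: of_real_diff)
    qed
    have F_lipschitz: "\<bar>F (\<phi> 0) - F (\<phi> \<mu>)\<bar> \<le> norm \<mu>"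
      if \<phi>: "holomorphic_disc D \<phi>" and \<mu>: "norm \<mu> \<le> \<sigma>" for \<phi> \<mu>
    proof -
      have "0 < (1 - \<sigma>) * r0 / 2" using \<sigma> r0 by simp
      then obtain N where N: "N > 0" "inverse (of_nat N) < (1 - \<sigma>) * r0 / 2"
        using ex_inverse_of_nat_less by blast
      \<comment> \<open>The segment from 0 to \<open>\<mu>\<close> is cut into \<open>N\<close>
        steps short enough for \<open>F_local\<close>. All nodes have modulus at most
        \<open>\<sigma>\<close>, so the one-sided bound can be used in both directions.\<close>
      define \<zeta> where "\<zeta> = (\<lambda>j. of_real (real j / real N) * \<mu>)"
      have bound: "norm (\<zeta> j) \<le> \<sigma>" if "j \<le> N" for j
      proof -
        have "norm (\<zeta> j) = real j / real N * norm \<mu>" by (simp add: \<zeta>_def norm_mult norm_divide)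
        also have "\<dots> \<le> 1 * norm \<mu>" using that N by (intro mult_right_mono) auto
        finally show ?thesis using \<mu> by simp
      qed
      have diff: "\<zeta> (Suc j) - \<zeta> j = of_real (1 / real N) * \<mu>" for j
        by (simp add: \<zeta>_def add_divide_distrib algebra_simps)
      have nd: "norm (\<zeta> (Suc j) - \<zeta> j) = norm \<mu> / real N" for j
        unfolding diff by (simp add: norm_mult norm_divide)
      have "norm \<mu> / real N \<le> 1 / real N" using \<mu> \<sigma> by (intro divide_right_mono) auto
      then have small: "norm (\<zeta> (Suc j) - \<zeta> j) < (1 - \<sigma>) * r0 / 2" for j
        using N(2) unfolding nd inverse_eq_divide by linarith
      have "\<bar>F (\<phi> 0) - F (\<phi> (\<zeta> j))\<bar> \<le> real j * (norm \<mu> / real N)" if "j \<le> N" for j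
        using that
      proof (induction j)
        case 0
        then show ?case by (simp add: \<zeta>_def)
      next
        case (Suc j)
        have "F (\<phi> (\<zeta> (Suc j))) \<le> F (\<phi> (\<zeta> j)) + norm \<mu> / real N"
          using F_local[OF \<phi> bound small, of j] Suc.prems by (simp add: nd)
        moreover have "F (\<phi> (\<zeta> j)) \<le> F (\<phi> (\<zeta> (Suc j))) + norm \<mu> / real N"
          using F_local[OF \<phi> bound[OF Suc.prems], of "\<zeta> j"] small[of j] nd[of j]
          by (simp add: norm_minus_commute)
        moreover have "real (Suc j) * (norm \<mu> / real N) = real j * (norm \<mu> / real N) + norm \<mu> / real N"
          by (simp add: algebra_simps add_divide_distrib)
        ultimately show ?case using Suc.IH Suc.prems by linarith
      qed
      from this[of N] show ?thesis using N by (simp add: \<zeta>_def)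
    qed
    have F_artanh: "\<bar>F (\<phi> 0) - F (\<phi> \<mu>)\<bar> \<le> artanh (norm \<mu>)"
      if \<phi>: "holomorphic_disc D \<phi>" and \<mu>: "norm \<mu> < 1" for \<phi> \<mu>
    proof (cases "norm \<mu> \<le> \<sigma>")
      case True
      then show ?thesis
        using F_lipschitz[OF \<phi> True] artanh_real_ge[of "norm \<mu>"] \<mu> by simp
    next
      case False
      then have "R \<le> artanh (norm \<mu>)"
        using artanh_real_mono[of \<sigma> "norm \<mu>"] \<sigma> \<mu> by (simp add: \<sigma>_def artanh_tanh_real)
      then show ?thesis
        using F_le[of "\<phi> 0"] F_le[of "\<phi> \<mu>"] F_nonneg[of "\<phi> 0"] F_nonneg[of "\<phi> \<mu>"] by linarith
    qed
    show ?thesis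
    proof
      fix w assume "w \<in> kobayashi_ball D z R"
      then have "kobayashi D z w < ennreal R" by (simp add: kobayashi_ball_def)
      with kobayashi_ge_abs_diff[where D = D and F = F and z = z and w = w, OF F_artanh]
      have "ennreal \<bar>F z - F w\<bar> < ennreal R" by (rule order_le_less_trans)
      \<comment> \<open>Since \<open>F z = 0\<close>, this says \<open>F w < R\<close>: truncation
        is not active at \<open>w\<close>, hence \<open>w\<close> lies in \<open>D'\<close> at
        distance below \<open>C * R\<close>.\<close>
      then have "\<bar>F z - F w\<bar> < R" by (simp add: ennreal_less_iff)
      moreover have "k z = 0"
        using kobayashi_largest(1)[of D'] zD' by (simp add: k_def pseudodistance_on_def)
      then have "F z = 0" using zD' by (simp add: F_def min_def)
      ultimately have "F w < R" by simp
      then show "w \<in> kobayashi_ball D' z (C * R)"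
        using F_less[of w] by (simp add: kobayashi_ball_def k_def)
    qed
  qed
  then show thesis
    using that[of "C * R" \<delta>] C R \<delta>(1) unfolding D'_def by simp
qed

end

section \<open>The Fridman invariant and the conclusion\<close>

lemma fridman_set_bdd:
  "bdd_above (insert 0 {tanh r | r f. r > 0 \<and> kobayashi_ball D z r \<subseteq> f ` ball (0 :: complex ^ 'n) 1 \<and>
     holomorphic_map_on (ball 0 1) D f \<and> inj_on f (ball 0 1)})"
  by (rule bdd_aboveI[of _ 1]) (auto intro: less_imp_le[OF tanh_real_lt_1])

lemma fridman_le_1: "fridman D z \<le> 1"
  unfolding fridman_def by (rule cSup_least) (auto intro: less_imp_le[OF tanh_real_lt_1])

text \<open>The strict inequality yields an injective map into \<open>D'\<close> whose image covers
  a Kobayashi ball of radius larger than \<open>C\<close>, hence also the ball of radius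
  \<open>R\<close> in \<open>D\<close>; the same map competes for \<open>D\<close>.\<close>

lemma tanh_le_fridman_of_kobayashi_ball_subset:
  fixes D D' :: "(complex ^ 'a) set"
  assumes "D' \<subseteq> D" "R > 0" "kobayashi_ball D z R \<subseteq> kobayashi_ball D' z C"
    and "tanh C < fridman D' z" "C > 0"
  shows "tanh R \<le> fridman D z"
proof -
  obtain r and f :: "complex ^ 'a \<Rightarrow> complex ^ 'a" where rf: "tanh C < tanh r" "r > 0" "kobayashi_ball D' z r \<subseteq> f ` ball 0 1"
    "holomorphic_map_on (ball 0 1) D' f" "inj_on f (ball 0 1)"
    using assms(4,5) unfolding fridman_def less_cSup_iff[OF insert_not_empty fridman_set_bdd]
    by auto
  have "kobayashi_ball D' z C \<subseteq> kobayashi_ball D' z r"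
    using rf(1,2) by (auto simp: kobayashi_ball_def ennreal_leI elim!: order_less_le_trans)
  then have "kobayashi_ball D z R \<subseteq> f ` ball 0 1" using assms(3) rf(3) by blast
  moreover have "holomorphic_map_on (ball 0 1) D f"
    using rf(4) assms(1) by (auto simp: holomorphic_map_on_def)
  ultimately show ?thesis
    unfolding fridman_def using assms(2) rf(5) by (intro cSup_upper fridman_set_bdd) blast
qed

lemma holomorphic_fun_on_subset:
  assumes "holomorphic_fun_on S f" "T \<subseteq> S" shows "holomorphic_fun_on T f"
  using assms unfolding holomorphic_fun_on_def by (meson has_derivative_subset subsetD)

theorem proposition3:
  fixes D U :: "(complex ^ 'n) set" and p\<^sub>0 :: "complex ^ 'n"
  assumes "domain D"
    and "local_holomorphic_peak_point D p\<^sub>0"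
    and "open U" and "p\<^sub>0 \<in> U"
    and "(fridman (D \<inter> U) \<longlongrightarrow> 1) (at p\<^sub>0 within (D \<inter> U))"
  shows "(fridman D \<longlongrightarrow> 1) (at p\<^sub>0 within D)"
proof -
  have D: "open D" using assms(1) by (simp add: domain_def)
  obtain W f where W: "open W" "p\<^sub>0 \<in> W" "holomorphic_fun_on (D \<inter> W) f"
    "continuous_on (closure D \<inter> W) f" "f p\<^sub>0 = 1"
    "\<And>z. z \<in> closure D \<inter> W - {p\<^sub>0} \<Longrightarrow> norm (f z) < 1"
    and p: "p\<^sub>0 \<in> frontier D"
    using assms(2) unfolding local_holomorphic_peak_point_def by blast
  obtain \<rho> where \<rho>: "\<rho> > 0" "cball p\<^sub>0 \<rho> \<subseteq> W \<inter> U"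
    using W(1,2) assms(3,4) open_contains_cball[of "W \<inter> U"] by blast
  interpret peak_function D p\<^sub>0 f \<rho>
  proof
    show "open D" "p\<^sub>0 \<in> closure D" "p\<^sub>0 \<notin> D" using D p by (auto simp: frontier_def interior_open)
    show "holomorphic_fun_on (D \<inter> ball p\<^sub>0 \<rho>) f"
      by (rule holomorphic_fun_on_subset[OF W(3)]) (use \<rho> ball_subset_cball in blast)
    show "continuous_on (closure D \<inter> cball p\<^sub>0 \<rho>) f"
      by (rule continuous_on_subset[OF W(4)]) (use \<rho> in blast)
    show "norm (f x) < 1" if "x \<in> closure D" "norm (x - p\<^sub>0) \<le> \<rho>" "x \<noteq> p\<^sub>0" for x
    proof -
      have "x \<in> cball p\<^sub>0 \<rho>" using that by (simp add: dist_norm norm_minus_commute)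
      then show ?thesis using that \<rho>(2) by (intro W(6)) blast
    qed
  qed (use \<rho> W in auto)
  show ?thesis
  proof (rule order_tendstoI)
    fix a :: real assume "1 < a"
    then show "eventually (\<lambda>z. fridman D z < a) (at p\<^sub>0 within D)"
      by (intro always_eventually allI) (rule order_le_less_trans[OF fridman_le_1])
  next
    fix a :: real assume "a < 1"
    obtain R where R: "R > 0" "a < tanh R"
    proof -
      have "eventually (\<lambda>x::real. a < tanh x \<and> x > 0) at_top"
        using order_tendstoD(1)[OF tanh_real_at_top \<open>a < 1\<close>] eventually_gt_at_top[of 0]
        by eventually_elim auto
      then show thesis using that eventually_happens'[OF trivial_limit_at_top_linorder] by blast
    qed
    obtain C \<delta> where C: "C > 0" "\<delta> > 0" "\<And>z. z \<in> D \<Longrightarrow> norm (z - p\<^sub>0) < \<delta> \<Longrightarrow>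
        kobayashi_ball D z R \<subseteq> kobayashi_ball (D \<inter> ball p\<^sub>0 \<rho>) z C"
      using kobayashi_ball_localization[OF R(1)] by blast
    \<comment> \<open>However large \<open>C\<close> is, \<open>tanh C < 1\<close>, so the assumed
      limit eventually exceeds it.\<close>
    have "eventually (\<lambda>z. tanh C < fridman (D \<inter> U) z) (at p\<^sub>0 within (D \<inter> U))"
      by (rule order_tendstoD(1)[OF assms(5) tanh_real_lt_1])
    moreover have "at p\<^sub>0 within (D \<inter> U) = at p\<^sub>0 within D"
      by (rule at_within_nhd[OF assms(4,3)]) auto
    ultimately have "eventually (\<lambda>z. tanh C < fridman (D \<inter> U) z) (at p\<^sub>0 within D)" by simp
    moreover have "eventually (\<lambda>z. z \<in> D \<and> norm (z - p\<^sub>0) < \<delta>) (at p\<^sub>0 within D)"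
      unfolding eventually_at using C(2) by (auto simp: dist_norm)
    ultimately show "eventually (\<lambda>z. a < fridman D z) (at p\<^sub>0 within D)"
    proof eventually_elim
      case (elim z)
      \<comment> \<open>Distances shrink when the domain grows, so balls of equal radius grow; this
        passes from the auxiliary ball to \<open>U\<close>.\<close>
      have "kobayashi_ball (D \<inter> ball p\<^sub>0 \<rho>) z C \<subseteq> kobayashi_ball (D \<inter> U) z C"
      proof -
        have "D \<inter> ball p\<^sub>0 \<rho> \<subseteq> D \<inter> U" using \<rho>(2) ball_subset_cball by blast
        then show ?thesis
          using kobayashi_mono_domain[of "D \<inter> ball p\<^sub>0 \<rho>" "D \<inter> U" z]
          by (auto simp: kobayashi_ball_def intro: order_le_less_trans)
      qed
      then have "tanh R \<le> fridman D z"
        using elim R C(1) C(3)[of z]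
        by (intro tanh_le_fridman_of_kobayashi_ball_subset[of "D \<inter> U" D R z C]) auto
      then show ?case using R(2) by simp
    qed
  qed
qed

end
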